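(* For every integer $M \ge 2$, let $C_M(\mathrm{SNR})$ be the capacity, in nats per symbol, of $M$-ary PSK over the AWGN channel with hard-decision detection (defined in the context). Then the first and second (one-sided) derivatives of $C_M(\mathrm{SNR})$ with respect to $\mathrm{SNR}$ at $\mathrm{SNR}=0$ are $$\dot{C}_M(0) = \begin{cases} \dfrac{2}{\pi} & M = 2,\\[4pt] \dfrac{M^2}{4\pi}\sin^2\dfrac{\pi}{M} & M \ge 3,\end{cases}$$ and $$\ddot{C}_M(0) = \begin{cases} \dfrac{8}{3\pi}\left(\dfrac{1}{\pi}-1\right) & M=2,\\[4pt] \infty & M = 3,\\[4pt] \dfrac{4}{3\pi}\left(\dfrac{1}{\pi}-1\right) & M=4,\\[4pt] \psi(M) & M\ge 5,\end{cases}$$ where $$\psi(M) = \frac{M^2}{16\pi^2}\left((2-\pi)\sin^2\frac{2\pi}{M} + (M^2-4\pi)\sin^4\frac{\pi}{M} - 2M\sin^2\frac{\pi}{M}\sin\frac{2\pi}{M}\right).$$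
   Context: AWGN channel with $M$-ary PSK and hard decisions: the input is $x\in\{0,\dots,M-1\}$; when $x=m$ the transmitted signal is $s_m=\sqrt{\mathcal{E}}\,e^{j2\pi m/M}$, $\mathcal{E}\ge 0$, and the received signal is $r=s_m+n$, where $n$ is a zero-mean circularly symmetric complex Gaussian random variable with $E\{|n|^2\}=N_0>0$, i.e. $r$ has conditional density $\frac{1}{\pi N_0}e^{-|r-s_m|^2/N_0}$ on $\mathbb{C}$. Set $\mathrm{SNR}=\mathcal{E}/N_0$. The maximum likelihood detector outputs $y=l\in\{0,\dots,M-1\}$ when $r$ lies in the sector $D_l=\{|r|e^{j\theta}: (2l-1)\pi/M\le\theta<(2l+1)\pi/M\}$ (angles modulo $2\pi$). Let $P_{l,0}=P(y=l\mid x=0)=P(r\in D_l\mid x=0)$, which depends only on $M$, $l$ and $\mathrm{SNR}$. The capacity of the resulting symmetric discrete memoryless channel is, in nats per symbol (natural logarithm), $$C_M(\mathrm{SNR})=\log M+\sum_{l=0}^{M-1}P_{l,0}\log P_{l,0},\qquad \mathrm{SNR}\ge 0.$$ Derivatives at $\mathrm{SNR}=0$ are one-sided (right) derivatives: $\ddot C_M(0)$ is the right derivative at $0$ of $\dot C_M$, with value $\infty$ meaning that the difference quotient tends to $+\infty$. *)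

theory Defs
  imports "HOL-Analysis.Analysis"
begin

definition psk_signal :: "nat \<Rightarrow> real \<Rightarrow> nat \<Rightarrow> complex" where
  "psk_signal M E m = of_real (sqrt E) * cis (2 * pi * real m / real M)"

text \<open>Law of the received signal when symbol \<open>m\<close> is sent with energy \<open>E\<close> and noise variance
  \<open>N0\<close>; \<open>lborel\<close> on \<^typ>\<open>complex\<close> is planar Lebesgue measure.\<close>

definition psk_received :: "nat \<Rightarrow> real \<Rightarrow> real \<Rightarrow> nat \<Rightarrow> complex measure" where
  "psk_received M E N0 m =
     density lborel (\<lambda>r. ennreal (1 / (pi * N0) * exp (- (cmod (r - psk_signal M E m))\<^sup>2 / N0)))"

text \<open>Writing points as \<open>\<rho> * cis \<theta>\<close> takes angles modulo \<open>2 * pi\<close>. The sectors share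
  only the origin, a null set.\<close>

definition psk_sector :: "nat \<Rightarrow> nat \<Rightarrow> complex set" where
  "psk_sector M l = {of_real \<rho> * cis \<theta> | \<rho> \<theta>. 0 \<le> \<rho> \<and>
     (2 * real l - 1) * pi / real M \<le> \<theta> \<and> \<theta> < (2 * real l + 1) * pi / real M}"

definition psk_prob :: "nat \<Rightarrow> real \<Rightarrow> real \<Rightarrow> nat \<Rightarrow> nat \<Rightarrow> real" where
  "psk_prob M E N0 l m = measure (psk_received M E N0 m) (psk_sector M l)"

text \<open>Capacity in nats as a function of the signal-to-noise ratio \<open>snr\<close>, realised at noise
  level \<open>N0\<close> by the signal energy \<open>snr * N0\<close>; the value does not depend on \<open>N0 > 0\<close>.
  The formula is the mutual information under the uniform input, which is optimal because the
  transition probability depends only on \<open>l - m\<close> modulo \<open>M\<close>.\<close>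

definition psk_capacity :: "nat \<Rightarrow> real \<Rightarrow> real \<Rightarrow> real" where
  "psk_capacity M N0 snr =
     ln (real M) + (\<Sum>l<M. psk_prob M (snr * N0) N0 l 0 * ln (psk_prob M (snr * N0) N0 l 0))"

definition psk_psi :: "nat \<Rightarrow> real" where
  "psk_psi M = (real M)\<^sup>2 / (16 * pi\<^sup>2) *
     ((2 - pi) * (sin (2 * pi / real M))\<^sup>2
      + ((real M)\<^sup>2 - 4 * pi) * (sin (pi / real M)) ^ 4
      - 2 * real M * (sin (pi / real M))\<^sup>2 * sin (2 * pi / real M))"

end

theory Submission
  imports Defs "HOL-Probability.Distributions" "HOL-Real_Asymp.Real_Asymp"
begin

text \<open>Put \<open>x = sqrt snr\<close>. In polar coordinates the probability of a sector is the integral over its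
  angles of an explicit density \<open>p x \<theta>\<close>, and \<open>p\<close> satisfies a conservation law: its derivative in \<open>x\<close> is
  the derivative in \<open>\<theta>\<close> of an explicit flux. Hence the sector probabilities are smooth in \<open>x\<close>, with
  \<open>x\<close>-derivative the difference of the fluxes through the two bounding rays, and their Taylor
  coefficients at \<open>x = 0\<close> can be read off. Inserting these into
  \<open>d/dx (\<Sum> P ln P) = \<Sum> P' ln (M P)\<close> gives \<open>\<alpha> x + \<beta> x\<^sup>2 + \<gamma> x\<^sup>3 + o(x\<^sup>3)\<close>, so the derivative in
  \<open>snr\<close> is \<open>(\<alpha> + \<beta> x + \<gamma> x\<^sup>2) / 2 + o(snr)\<close>. The coefficient \<open>\<beta>\<close> is proportional to the sum of
  \<open>cos\<^sup>3\<close> over the constellation, which vanishes unless \<open>M = 3\<close>; then it is positive and the second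
  derivative is infinite. The cases \<open>M = 2\<close> and \<open>M = 4\<close> are special because \<open>\<alpha>\<close> and \<open>\<gamma>\<close> involve the
  sums of \<open>cos\<^sup>2\<close> and \<open>cos\<^sup>4\<close>.\<close>

section \<open>Polar coordinates in the complex plane\<close>

text \<open>Lebesgue measure is determined by its values on boxes, and a box in
  \<open>complex\<close> is the product of an interval for the real part and one for the imaginary
  part. This opens the plane to iterated integrals.\<close>

lemma lborel_complex:
  "distr (lborel \<Otimes>\<^sub>M lborel) borel (\<lambda>(x, y). Complex x y) = lborel"
proof (rule lborel_eqI[symmetric])
  have [measurable]: "(\<lambda>(x, y). Complex x y) \<in> borel_measurable (lborel \<Otimes>\<^sub>M lborel)"
    unfolding Complex_eq by measurable
  fix l u :: complex
  assume lu: "\<And>b. b \<in> Basis \<Longrightarrow> l \<bullet> b \<le> u \<bullet> b"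
  have le: "Re l \<le> Re u" "Im l \<le> Im u"
    using lu[of 1] lu[of \<i>] by (auto simp: Basis_complex_def)
  have "(\<lambda>(x, y). Complex x y) -` box l u \<inter> space (lborel \<Otimes>\<^sub>M lborel)
      = {Re l<..<Re u} \<times> {Im l<..<Im u}"
    by (auto simp: box_def Basis_complex_def space_pair_measure)
  then show "emeasure (distr (lborel \<Otimes>\<^sub>M lborel) borel (\<lambda>(x, y). Complex x y)) (box l u)
      = (\<Prod>b\<in>Basis. (u - l) \<bullet> b)"
    using le by (simp add: emeasure_distr lborel.emeasure_pair_measure_Times Basis_complex_def
        ennreal_mult)
qed simp

lemma nn_integral_complex:
  assumes [measurable]: "f \<in> borel_measurable borel"
  shows "(\<integral>\<^sup>+z. f z \<partial>lborel) = (\<integral>\<^sup>+x. \<integral>\<^sup>+y. f (Complex x y) \<partial>lborel \<partial>lborel)"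
proof -
  have [measurable]: "(\<lambda>(x, y). Complex x y) \<in> borel_measurable (lborel \<Otimes>\<^sub>M lborel)"
    unfolding Complex_eq by measurable
  have "(\<integral>\<^sup>+z. f z \<partial>lborel) = (\<integral>\<^sup>+p. f (case p of (x, y) \<Rightarrow> Complex x y) \<partial>(lborel \<Otimes>\<^sub>M lborel))"
    by (subst lborel_complex[symmetric]) (simp add: nn_integral_distr)
  also have "\<dots> = (\<integral>\<^sup>+x. \<integral>\<^sup>+y. f (Complex x y) \<partial>lborel \<partial>lborel)"
    by (subst lborel.nn_integral_fst[symmetric]) simp_all
  finally show ?thesis .
qed

text \<open>The substitution \<open>y = tan \<theta>\<close> has a derivative that is unbounded at
  the ends. It is therefore made on compact intervals, and continuity from below of the two density
  measures passes to the limit.\<close>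

lemma nn_integral_tan:
  fixes g :: "real \<Rightarrow> ennreal"
  assumes [measurable]: "g \<in> borel_measurable borel"
  shows "(\<integral>\<^sup>+y. g y \<partial>lborel)
    = (\<integral>\<^sup>+\<theta>. g (tan \<theta>) * ennreal (1 / (cos \<theta>)\<^sup>2) * indicator {- (pi / 2)..<pi / 2} \<theta> \<partial>lborel)"
proof -
  let ?h = "\<lambda>\<theta>. g (tan \<theta>) * ennreal (1 / (cos \<theta>)\<^sup>2)"
  \<comment> \<open>Taking \<open>Suc n\<close> and not \<open>n\<close> keeps every interval
    nondegenerate, as the substitution requires.\<close>
  let ?A = "\<lambda>n::nat. {- real (Suc n)..real (Suc n)}" and ?B = "\<lambda>n::nat. {arctan (- real (Suc n))..arctan (real (Suc n))}"
  have [measurable]: "tan \<in> borel_measurable (borel :: real measure)"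
    unfolding tan_def by measurable
  have cos_pos: "cos \<theta> > 0" if "\<theta> \<in> ?B n" for \<theta> n
    using that arctan_bounded[of "real (Suc n)"] arctan_bounded[of "- real (Suc n)"]
    by (intro cos_gt_zero_pi) (auto simp del: arctan_minus of_nat_Suc)
  have UA: "(\<Union>n. ?A n) = UNIV"
  proof -
    have "\<exists>n. x \<in> ?A n" for x :: real
    proof -
      obtain n :: nat where "\<bar>x\<bar> \<le> real n" using real_arch_simple by blast
      then show ?thesis by (intro exI[of _ n]) auto
    qed
    then show ?thesis by auto
  qed
  have UB: "(\<Union>n. ?B n) = {- (pi / 2)<..<pi / 2}"
  proof (intro set_eqI iffI)
    fix \<theta> assume "\<theta> \<in> (\<Union>n. ?B n)"
    then obtain n where "arctan (- real (Suc n)) \<le> \<theta>" "\<theta> \<le> arctan (real (Suc n))" by (auto simp del: arctan_minus of_nat_Suc)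
    then show "\<theta> \<in> {- (pi / 2)<..<pi / 2}"
      using arctan_bounded[of "real (Suc n)"] arctan_bounded[of "- real (Suc n)"] by (auto simp del: arctan_minus of_nat_Suc)
  next
    fix \<theta> assume \<theta>: "\<theta> \<in> {- (pi / 2)<..<pi / 2}"
    obtain n where "tan \<theta> \<in> ?A n" using UA by blast
    then have "arctan (- real (Suc n)) \<le> arctan (tan \<theta>)" "arctan (tan \<theta>) \<le> arctan (real (Suc n))"
      by (auto simp only: arctan_le_iff atLeastAtMost_iff)
    then show "\<theta> \<in> (\<Union>n. ?B n)"
      using \<theta> by (intro UN_I[of n]) (auto simp: arctan_tan)
  qed
  have step: "emeasure (density lborel g) (?A n) = emeasure (density lborel ?h) (?B n)" for n
  proof -
    have "(\<integral>\<^sup>+y. g y * indicator {tan (arctan (- real (Suc n)))..tan (arctan (real (Suc n)))} y \<partial>lborel)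
       = (\<integral>\<^sup>+\<theta>. ?h \<theta> * indicator (?B n) \<theta> \<partial>lborel)"
    proof (rule nn_integral_substitution_aux)
      show "(tan has_real_derivative 1 / (cos \<theta>)\<^sup>2) (at \<theta>)" if "\<theta> \<in> ?B n" for \<theta>
        using DERIV_tan[of \<theta>] cos_pos[OF that] by (simp add: inverse_eq_divide)
      show "continuous_on (?B n) (\<lambda>\<theta>. 1 / (cos \<theta>)\<^sup>2)"
        using cos_pos by (intro continuous_intros) (metis less_irrefl power_eq_0_iff)
      show "arctan (- real (Suc n)) < arctan (real (Suc n))"
        by (simp only: arctan_less_iff)
    qed auto
    then show ?thesis
      by (simp add: emeasure_density tan_arctan del: arctan_minus of_nat_Suc)
  qed
  have "(\<integral>\<^sup>+y. g y \<partial>lborel) = emeasure (density lborel g) (\<Union>n. ?A n)"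
    by (subst UA) (simp add: emeasure_density)
  also have "\<dots> = (SUP n. emeasure (density lborel g) (?A n))"
    by (rule SUP_emeasure_incseq[symmetric]) (auto simp: incseq_def)
  also have "\<dots> = (SUP n. emeasure (density lborel ?h) (?B n))"
    by (simp only: step)
  also have "\<dots> = emeasure (density lborel ?h) (\<Union>n. ?B n)"
    by (rule SUP_emeasure_incseq) (auto simp: incseq_def arctan_le_iff intro: order_trans simp del: arctan_minus of_nat_Suc)
  also have "\<dots> = (\<integral>\<^sup>+\<theta>. ?h \<theta> * indicator {- (pi / 2)<..<pi / 2} \<theta> \<partial>lborel)"
    by (subst UB) (simp add: emeasure_density)
  also have "\<dots> = (\<integral>\<^sup>+\<theta>. ?h \<theta> * indicator {- (pi / 2)..<pi / 2} \<theta> \<partial>lborel)"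
    using AE_lborel_singleton[of "- (pi / 2)"]
    by (intro nn_integral_cong_AE, eventually_elim) (auto simp: indicator_def)
  finally show ?thesis .
qed


lemma measurable_cis [measurable]: "cis \<in> borel_measurable borel"
  unfolding cis_conv_exp by (intro borel_measurable_continuous_onI continuous_intros)

text \<open>Two one-dimensional substitutions do the work: \<open>y = x * tan \<theta>\<close> at
  fixed \<open>x\<close> and, after exchanging the integrals,
  \<open>x = \<rho> * cos \<theta>\<close> at fixed \<open>\<theta>\<close>. The factors
  \<open>x / (cos \<theta>)\<^sup>2\<close> and \<open>cos \<theta>\<close> combine to the Jacobian
  \<open>\<rho>\<close>.\<close>

lemma nn_integral_half_plane_polar:
  assumes [measurable]: "f \<in> borel_measurable borel"
  shows "(\<integral>\<^sup>+x. (\<integral>\<^sup>+y. f (Complex x y) \<partial>lborel) * indicator {0<..} x \<partial>lborel)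
    = (\<integral>\<^sup>+\<theta>. (\<integral>\<^sup>+\<rho>. ennreal \<rho> * f (of_real \<rho> * cis \<theta>) * indicator {0<..} \<rho> \<partial>lborel)
        * indicator {- (pi / 2)..<pi / 2} \<theta> \<partial>lborel)"
proof -
  have [measurable]: "tan \<in> borel_measurable (borel :: real measure)"
    unfolding tan_def by measurable
  have [measurable]: "(\<lambda>y. f (Complex x y)) \<in> borel_measurable borel" for x
    unfolding Complex_eq by measurable
  let ?I = "{- (pi / 2)..<pi / 2}"
  let ?k = "\<lambda>x \<theta>. ennreal (x / (cos \<theta>)\<^sup>2) * f (Complex x (x * tan \<theta>)) * indicator {0<..} x * indicator ?I \<theta>"
  have [measurable]: "case_prod ?k \<in> borel_measurable (lborel \<Otimes>\<^sub>M lborel)"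
    unfolding Complex_eq by measurable
  have "(\<integral>\<^sup>+y. f (Complex x y) \<partial>lborel) * indicator {0<..} x = (\<integral>\<^sup>+\<theta>. ?k x \<theta> \<partial>lborel)" for x
  proof (cases "x > 0")
    case True
    have "(\<integral>\<^sup>+y. f (Complex x y) \<partial>lborel) = ennreal x * (\<integral>\<^sup>+y. f (Complex x (x * y)) \<partial>lborel)"
      using True by (subst nn_integral_real_affine[where c = x and t = 0]) simp_all
    also have "\<dots> = ennreal x * (\<integral>\<^sup>+\<theta>. f (Complex x (x * tan \<theta>)) * ennreal (1 / (cos \<theta>)\<^sup>2) * indicator ?I \<theta> \<partial>lborel)"
      by (subst nn_integral_tan) (simp_all add: Complex_eq)
    also have "\<dots> = (\<integral>\<^sup>+\<theta>. ennreal x * (f (Complex x (x * tan \<theta>)) * ennreal (1 / (cos \<theta>)\<^sup>2) * indicator ?I \<theta>) \<partial>lborel)"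
      by (subst nn_integral_cmult) (simp_all add: Complex_eq)
    also have "\<dots> = (\<integral>\<^sup>+\<theta>. ?k x \<theta> \<partial>lborel)"
    proof (rule nn_integral_cong)
      fix \<theta>
      have "ennreal (x / (cos \<theta>)\<^sup>2) = ennreal x * ennreal (1 / (cos \<theta>)\<^sup>2)"
        using True by (subst ennreal_mult[symmetric]) auto
      then show "ennreal x * (f (Complex x (x * tan \<theta>)) * ennreal (1 / (cos \<theta>)\<^sup>2) * indicator ?I \<theta>) = ?k x \<theta>"
        using True by (simp add: ac_simps)
    qed
    finally show ?thesis using True by simp
  qed simp
  then have "(\<integral>\<^sup>+x. (\<integral>\<^sup>+y. f (Complex x y) \<partial>lborel) * indicator {0<..} x \<partial>lborel)
      = (\<integral>\<^sup>+x. \<integral>\<^sup>+\<theta>. ?k x \<theta> \<partial>lborel \<partial>lborel)"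
    by simp
  also have "\<dots> = (\<integral>\<^sup>+\<theta>. \<integral>\<^sup>+x. ?k x \<theta> \<partial>lborel \<partial>lborel)"
    by (rule lborel_pair.Fubini'[symmetric]) measurable
  also have "\<dots> = (\<integral>\<^sup>+\<theta>. (\<integral>\<^sup>+\<rho>. ennreal \<rho> * f (of_real \<rho> * cis \<theta>) * indicator {0<..} \<rho> \<partial>lborel)
        * indicator ?I \<theta> \<partial>lborel)"
  proof (intro nn_integral_cong_AE, use AE_lborel_singleton[of "- (pi / 2)"] in eventually_elim)
    fix \<theta> :: real assume ne: "\<theta> \<noteq> - (pi / 2)"
    show "(\<integral>\<^sup>+x. ?k x \<theta> \<partial>lborel)
      = (\<integral>\<^sup>+\<rho>. ennreal \<rho> * f (of_real \<rho> * cis \<theta>) * indicator {0<..} \<rho> \<partial>lborel) * indicator ?I \<theta>"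
    proof (cases "\<theta> \<in> ?I")
      case True
      then have c: "cos \<theta> > 0"
        using ne by (intro cos_gt_zero_pi) auto
      have "(\<integral>\<^sup>+x. ?k x \<theta> \<partial>lborel) = ennreal \<bar>cos \<theta>\<bar> * (\<integral>\<^sup>+\<rho>. ?k (0 + cos \<theta> * \<rho>) \<theta> \<partial>lborel)"
        by (rule nn_integral_real_affine) (use c in \<open>simp_all add: Complex_eq\<close>)
      also have "\<dots> = (\<integral>\<^sup>+\<rho>. ennreal (cos \<theta>) * ?k (0 + cos \<theta> * \<rho>) \<theta> \<partial>lborel)"
        using c by (subst nn_integral_cmult) (simp_all add: Complex_eq)
      also have "\<dots> = (\<integral>\<^sup>+\<rho>. ennreal \<rho> * f (of_real \<rho> * cis \<theta>) * indicator {0<..} \<rho> \<partial>lborel)"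
      proof (rule nn_integral_cong)
        fix \<rho> :: real
        show "ennreal (cos \<theta>) * ?k (0 + cos \<theta> * \<rho>) \<theta> = ennreal \<rho> * f (of_real \<rho> * cis \<theta>) * indicator {0<..} \<rho>"
        proof (cases "\<rho> > 0")
          case \<rho>: True
          have z: "Complex (cos \<theta> * \<rho>) (cos \<theta> * \<rho> * tan \<theta>) = of_real \<rho> * cis \<theta>"
            using c by (simp add: complex_eq_iff tan_def)
          have m: "ennreal (cos \<theta>) * ennreal (cos \<theta> * \<rho> / (cos \<theta>)\<^sup>2) = ennreal \<rho>"
            using c \<rho> by (subst ennreal_mult[symmetric]) (auto simp: power2_eq_square)
          have "ennreal (cos \<theta>) * ?k (0 + cos \<theta> * \<rho>) \<theta>
              = ennreal (cos \<theta>) * ennreal (cos \<theta> * \<rho> / (cos \<theta>)\<^sup>2) * f (of_real \<rho> * cis \<theta>)"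
            using c \<rho> True by (simp add: z[unfolded mult.assoc] mult.assoc)
          then show ?thesis using \<rho> by (simp add: m)
        next
          case False
          then have "\<not> 0 + cos \<theta> * \<rho> > 0" using c by (simp add: zero_less_mult_iff)
          then show ?thesis using False by simp
        qed
      qed
      finally show ?thesis using True by simp
    qed simp
  qed
  finally show ?thesis .
qed


text \<open>The left half-plane is the right one reflected in the origin, which shifts angles by
  \<open>pi\<close>; the imaginary axis is a null set. The range of angles is then cut at
  \<open>c\<close> and its first piece moved by a full turn, so that it can begin at the boundary of
  a decision sector.\<close>

theorem nn_integral_polar:
  assumes [measurable]: "f \<in> borel_measurable borel" and c: "- (pi / 2) \<le> c" "c \<le> pi / 2"
  shows "(\<integral>\<^sup>+z. f z \<partial>lborel)
    = (\<integral>\<^sup>+\<theta>. (\<integral>\<^sup>+\<rho>. ennreal \<rho> * f (of_real \<rho> * cis \<theta>) * indicator {0<..} \<rho> \<partial>lborel)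
        * indicator {c..<c + 2 * pi} \<theta> \<partial>lborel)"
proof -
  define h where "h \<theta> = (\<integral>\<^sup>+\<rho>. ennreal \<rho> * f (of_real \<rho> * cis \<theta>) * indicator {0<..} \<rho> \<partial>lborel)"
    for \<theta> :: real
  define T where "T a b = (\<integral>\<^sup>+\<theta>. h \<theta> * indicator {a..<b} \<theta> \<partial>lborel)" for a b
  have [measurable]: "h \<in> borel_measurable borel"
    unfolding h_def by measurable
  have T_add: "T a b + T b d = T a d" if "a \<le> b" "b \<le> d" for a b d
    unfolding T_def using that
    by (subst nn_integral_add[symmetric]) (auto intro!: nn_integral_cong split: split_indicator)
  have T_shift: "T (a + t) (b + t) = (\<integral>\<^sup>+\<theta>. h (\<theta> + t) * indicator {a..<b} \<theta> \<partial>lborel)" for a b t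
    unfolding T_def
    by (subst nn_integral_real_affine[where c = 1 and t = t])
      (auto intro!: nn_integral_cong split: split_indicator simp: add.commute)
  have h_periodic: "h (\<theta> + 2 * pi) = h \<theta>" for \<theta>
    by (simp add: h_def cis_mult[symmetric])
  have [measurable]: "(\<lambda>y. f (Complex x y)) \<in> borel_measurable borel" for x
    unfolding Complex_eq by measurable
  let ?J = "\<lambda>x. \<integral>\<^sup>+y. f (Complex x y) \<partial>lborel"
  have [measurable]: "?J \<in> borel_measurable borel"
    unfolding Complex_eq by measurable
  have right: "(\<integral>\<^sup>+x. ?J x * indicator {0<..} x \<partial>lborel) = T (- (pi / 2)) (pi / 2)"
    unfolding T_def h_def by (rule nn_integral_half_plane_polar) simp
  have "(\<integral>\<^sup>+x. ?J x * indicator {..<0} x \<partial>lborel)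
      = (\<integral>\<^sup>+x. (\<integral>\<^sup>+y. f (- Complex x y) \<partial>lborel) * indicator {0<..} x \<partial>lborel)"
  proof -
    have "?J (- x) = (\<integral>\<^sup>+y. f (- Complex x y) \<partial>lborel)" for x
      by (subst nn_integral_real_affine[where c = "-1" and t = 0]) (simp_all add: Complex_eq)
    then show ?thesis
      by (subst nn_integral_real_affine[where c = "-1" and t = 0])
        (auto intro!: nn_integral_cong split: split_indicator)
  qed
  also have "\<dots> = (\<integral>\<^sup>+\<theta>. h (\<theta> + pi) * indicator {- (pi / 2)..<pi / 2} \<theta> \<partial>lborel)"
    unfolding h_def by (subst nn_integral_half_plane_polar) (simp_all add: cis_mult[symmetric])
  also have "\<dots> = T (pi / 2) (3 * pi / 2)"
    by (subst T_shift[symmetric]) (simp add: field_simps)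
  finally have left: "(\<integral>\<^sup>+x. ?J x * indicator {..<0} x \<partial>lborel) = T (pi / 2) (3 * pi / 2)" .
  have "(\<integral>\<^sup>+z. f z \<partial>lborel) = (\<integral>\<^sup>+x. ?J x \<partial>lborel)"
    by (rule nn_integral_complex) simp
  also have "\<dots> = (\<integral>\<^sup>+x. ?J x * indicator {0<..} x + ?J x * indicator {..<0} x \<partial>lborel)"
    by (intro nn_integral_cong_AE, use AE_lborel_singleton[of 0] in eventually_elim)
      (auto split: split_indicator)
  also have "\<dots> = T (- (pi / 2)) (pi / 2) + T (pi / 2) (3 * pi / 2)"
    by (subst nn_integral_add) (simp_all add: left right)
  also have "\<dots> = (T (- (pi / 2)) c + T c (pi / 2)) + T (pi / 2) (3 * pi / 2)"
    using c by (simp add: T_add)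
  also have "\<dots> = T c (3 * pi / 2) + T (- (pi / 2)) c"
    using c by (subst T_add[of c "pi / 2" "3 * pi / 2", symmetric]) (auto simp: ac_simps)
  also have "T (- (pi / 2)) c = T (3 * pi / 2) (c + 2 * pi)"
    using T_shift[of "- (pi / 2)" "2 * pi" c] by (simp add: h_periodic T_def)
  also have "T c (3 * pi / 2) + \<dots> = T c (c + 2 * pi)"
    using c by (intro T_add) auto
  finally show ?thesis
    by (simp add: T_def h_def)
qed

section \<open>Angular density of the received signal\<close>

text \<open>The integral of \<open>exp (- t\<^sup>2)\<close> from minus infinity to
  \<open>c\<close>, with total mass \<open>sqrt pi\<close>. Splitting off the known half mass leaves
  a bounded interval of integration.\<close>

definition gauss_cdf :: "real \<Rightarrow> real" where
  "gauss_cdf c = sqrt pi / 2 + (LBINT t=0..c. exp (- t\<^sup>2))"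

lemma gauss_cdf_0 [simp]: "gauss_cdf 0 = sqrt pi / 2"
  by (simp add: gauss_cdf_def zero_ereal_def)

lemma DERIV_gauss_cdf: "(gauss_cdf has_real_derivative exp (- c\<^sup>2)) (at c)"
proof -
  have "((\<lambda>u. LBINT t=0..u. exp (- t\<^sup>2)) has_vector_derivative exp (- c\<^sup>2))
      (at c within {- (\<bar>c\<bar> + 1)..\<bar>c\<bar> + 1})"
    unfolding zero_ereal_def by (intro interval_integral_FTC2 continuous_intros) auto
  then have "((\<lambda>u. LBINT t=0..u. exp (- t\<^sup>2)) has_vector_derivative exp (- c\<^sup>2)) (at c)"
    by (subst (asm) at_within_interior) auto
  then show ?thesis
    unfolding gauss_cdf_def
    by (auto intro!: derivative_eq_intros simp: has_real_derivative_iff_has_vector_derivative)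
qed

lemma DERIV_gauss_cdf_chain [derivative_intros]:
  "(g has_real_derivative d) (at x within S) \<Longrightarrow>
    ((\<lambda>x. gauss_cdf (g x)) has_real_derivative exp (- (g x)\<^sup>2) * d) (at x within S)"
  by (rule DERIV_chain2[OF DERIV_gauss_cdf])

lemma continuous_on_gauss_cdf [continuous_intros]:
  "continuous_on S g \<Longrightarrow> continuous_on S (\<lambda>x. gauss_cdf (g x))"
  by (rule continuous_on_compose2[of UNIV gauss_cdf])
    (auto intro!: DERIV_continuous_on DERIV_gauss_cdf)

text \<open>The Gaussian is even, so \<open>gauss_cdf (- c) + gauss_cdf c\<close> has derivative
  zero and keeps its value at \<open>0\<close>.\<close>

lemma gauss_cdf_minus: "gauss_cdf (- c) = sqrt pi - gauss_cdf c"
proof -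
  have "((\<lambda>c. gauss_cdf (- c) + gauss_cdf c) has_real_derivative 0) (at c)" for c
    by (auto intro!: derivative_eq_intros)
  then have "gauss_cdf (- c) + gauss_cdf c = gauss_cdf (- 0) + gauss_cdf 0"
    by (intro DERIV_isconst_all) blast
  then show ?thesis by simp
qed

lemma tendsto_gauss_cdf: "(gauss_cdf \<longlongrightarrow> sqrt pi) at_top"
proof -
  have "set_integrable lborel {0..} (\<lambda>t. exp (- t\<^sup>2) :: real)"
    and lim: "set_lebesgue_integral lborel {0..} (\<lambda>t. exp (- t\<^sup>2)) = sqrt pi / 2"
    using gaussian_moment_0
    by (auto simp: has_bochner_integral_iff set_integrable_def set_lebesgue_integral_def)
  then have "((\<lambda>b. set_lebesgue_integral lborel {0..b} (\<lambda>t. exp (- t\<^sup>2)))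
      \<longlongrightarrow> sqrt pi / 2) at_top"
    unfolding lim[symmetric] by (intro tendsto_set_lebesgue_integral_at_top) auto
  then have "((\<lambda>b. sqrt pi / 2 + set_lebesgue_integral lborel {0..b} (\<lambda>t. exp (- t\<^sup>2)))
      \<longlongrightarrow> sqrt pi / 2 + sqrt pi / 2) at_top"
    by (intro tendsto_intros)
  then show ?thesis
  proof (rule filterlim_cong[THEN iffD1, rotated -1])
    show "\<forall>\<^sub>F b in at_top. sqrt pi / 2 + set_lebesgue_integral lborel {0..b} (\<lambda>t. exp (- t\<^sup>2))
        = gauss_cdf b"
      using eventually_ge_at_top[of 0]
      by eventually_elim (simp add: gauss_cdf_def interval_integral_Icc zero_ereal_def)
  qed simp_all
qed

section \<open>Integration of the Gaussian density along a ray\<close>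

text \<open>Density of the received angle for noise variance 1 and the real signal \<open>x\<close>:
  the closed form of the integral over \<open>t \<ge> 0\<close> of \<open>t / pi * exp (- (cmod
  (of_real t * cis \<theta> - of_real x))\<^sup>2)\<close>.\<close>

definition angle_density :: "real \<Rightarrow> real \<Rightarrow> real" where
  "angle_density x \<theta> = exp (- x\<^sup>2) / (2 * pi)
     + x * cos \<theta> * exp (- (x * sin \<theta>)\<^sup>2) * gauss_cdf (x * cos \<theta>) / pi"

text \<open>A primitive in \<open>t\<close> of the polar density on the ray of angle
  \<open>\<theta>\<close>, found by splitting \<open>t\<close> into
  \<open>t - x * cos \<theta>\<close> and \<open>x * cos \<theta>\<close>: the first part integrates
  to an exponential, the second to \<open>gauss_cdf\<close>.\<close>

definition radial_primitive :: "real \<Rightarrow> real \<Rightarrow> real \<Rightarrow> real" where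
  "radial_primitive x \<theta> t = exp (- (x * sin \<theta>)\<^sup>2) / pi *
     (x * cos \<theta> * gauss_cdf (t - x * cos \<theta>) - exp (- (t - x * cos \<theta>)\<^sup>2) / 2)"

lemma cmod_polar_diff:
  "(cmod (of_real \<rho> * cis \<theta> - of_real x))\<^sup>2 = (\<rho> - x * cos \<theta>)\<^sup>2 + (x * sin \<theta>)\<^sup>2"
  by (simp add: cmod_power2 power2_diff power_mult_distrib sin_squared_eq) (simp add: algebra_simps)

lemma DERIV_radial_primitive:
  "(radial_primitive x \<theta> has_real_derivative
     t / pi * exp (- (cmod (of_real t * cis \<theta> - of_real x))\<^sup>2)) (at t)"
proof -
  let ?b = "x * cos \<theta>"
  have "(radial_primitive x \<theta> has_real_derivative
      exp (- (x * sin \<theta>)\<^sup>2) / pi * (?b * exp (- (t - ?b)\<^sup>2) + (t - ?b) * exp (- (t - ?b)\<^sup>2))) (at t)"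
    unfolding radial_primitive_def by (auto intro!: derivative_eq_intros simp: field_simps)
  moreover have "exp (- ((t - ?b)\<^sup>2 + (x * sin \<theta>)\<^sup>2)) = exp (- (t - ?b)\<^sup>2) * exp (- (x * sin \<theta>)\<^sup>2)"
    by (simp flip: exp_add)
  ultimately show ?thesis
    unfolding cmod_polar_diff by (simp add: algebra_simps)
qed

text \<open>At infinity only the \<open>gauss_cdf\<close> term survives, with value
  \<open>sqrt pi\<close>. The reflection formula for the value at \<open>0\<close> then turns the
  increment into the angular density.\<close>

lemma tendsto_radial_primitive:
  "(radial_primitive x \<theta> \<longlongrightarrow> radial_primitive x \<theta> 0 + angle_density x \<theta>) at_top"
proof -
  have sc: "x\<^sup>2 = (x * sin \<theta>)\<^sup>2 + (x * cos \<theta>)\<^sup>2"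
    by (simp add: power_mult_distrib flip: distrib_left)
  have shift: "filterlim (\<lambda>t. t - x * cos \<theta>) at_top at_top"
    by real_asymp
  have e0: "((\<lambda>t. exp (- t\<^sup>2)) \<longlongrightarrow> 0) (at_top :: real filter)"
    by real_asymp
  have "(radial_primitive x \<theta> \<longlongrightarrow>
      exp (- (x * sin \<theta>)\<^sup>2) / pi * (x * cos \<theta> * sqrt pi - 0 / 2)) at_top"
    unfolding radial_primitive_def
    by (intro tendsto_intros filterlim_compose[OF tendsto_gauss_cdf shift] filterlim_compose[OF e0 shift]) simp
  also have "exp (- (x * sin \<theta>)\<^sup>2) / pi * (x * cos \<theta> * sqrt pi - 0 / 2)
      = radial_primitive x \<theta> 0 + angle_density x \<theta>"
    unfolding radial_primitive_def angle_density_def sc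
    by (simp add: gauss_cdf_minus exp_add exp_diff exp_minus field_simps)
  finally show ?thesis .
qed

lemma nn_integral_radial:
  "(\<integral>\<^sup>+t. ennreal (t / pi * exp (- (cmod (of_real t * cis \<theta> - of_real x))\<^sup>2)) * indicator {0..} t \<partial>lborel)
    = ennreal (angle_density x \<theta>)"
  by (subst nn_integral_FTC_atLeast[OF _ DERIV_radial_primitive _ tendsto_radial_primitive]) auto

text \<open>The closed form has a negative summand when \<open>x * cos \<theta> < 0\<close>, so
  positivity is read off the radial integral: its primitive increases strictly on
  \<open>[0, 1]\<close> and does not decrease afterwards.\<close>

lemma angle_density_pos: "angle_density x \<theta> > 0"
proof -
  have mono: "radial_primitive x \<theta> 1 \<le> radial_primitive x \<theta> t" if "t \<ge> 1" for t
    using that by (intro DERIV_nonneg_imp_nondecreasing[OF that])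
      (meson DERIV_radial_primitive divide_nonneg_pos exp_ge_zero mult_nonneg_nonneg order_trans pi_gt_zero zero_le_one)
  have "radial_primitive x \<theta> 0 < radial_primitive x \<theta> 1"
    by (rule DERIV_pos_imp_increasing_open[of 0 1])
      (auto intro!: exI DERIV_radial_primitive DERIV_continuous_on DERIV_subset[OF DERIV_radial_primitive])
  also have "\<dots> \<le> radial_primitive x \<theta> 0 + angle_density x \<theta>"
    by (rule tendsto_lowerbound[OF tendsto_radial_primitive])
      (auto intro!: eventually_mono[OF eventually_ge_at_top[of 1]] mono)
  finally show ?thesis by simp
qed

section \<open>Probability of a decision sector\<close>

lemma continuous_on_angle_density [continuous_intros]:
  fixes f g :: "'a :: t2_space \<Rightarrow> real"
  shows "continuous_on S f \<Longrightarrow> continuous_on S g \<Longrightarrow> continuous_on S (\<lambda>x. angle_density (f x) (g x))"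
  unfolding angle_density_def
  by (intro continuous_intros) auto

text \<open>The range of angles is half-open, so the sector is exhausted by compact images of polar
  rectangles. One index both bounds the radius and keeps the angle away from the open end.\<close>

lemma psk_sector_borel: "psk_sector M l \<in> sets borel"
proof -
  let ?a = "(2 * real l - 1) * pi / real M" and ?b = "(2 * real l + 1) * pi / real M"
  let ?f = "\<lambda>p. of_real (fst p) * cis (snd p)"
  let ?K = "\<lambda>n. ?f ` ({0..real n} \<times> {?a..?b - 1 / real (Suc n)})"
  have "compact (?K n)" for n
    by (intro compact_continuous_image compact_Times compact_Icc continuous_intros)
  then have "?K n \<in> sets borel" for n
    by (intro borel_closed compact_imp_closed)
  then have "(\<Union>n. ?K n) \<in> sets borel"
    by (intro sets.countable_UN) blast
  also have "(\<Union>n. ?K n) = psk_sector M l"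
  proof (intro set_eqI iffI)
    fix z assume "z \<in> (\<Union>n. ?K n)"
    then obtain n \<rho> \<theta> where z: "z = of_real \<rho> * cis \<theta>" "0 \<le> \<rho>" "?a \<le> \<theta>" "\<theta> \<le> ?b - 1 / real (Suc n)"
      by auto
    have "0 < 1 / real (Suc n)" by simp
    then have "\<theta> < ?b" using z(4) by linarith
    with z show "z \<in> psk_sector M l"
      unfolding psk_sector_def by blast
  next
    fix z assume "z \<in> psk_sector M l"
    then obtain \<rho> \<theta> where z: "z = of_real \<rho> * cis \<theta>" "0 \<le> \<rho>" "?a \<le> \<theta>" "\<theta> < ?b"
      unfolding psk_sector_def by blast
    obtain m :: nat where m: "\<rho> \<le> real m" using real_arch_simple by blast
    obtain k :: nat where k: "inverse (real (Suc k)) < ?b - \<theta>"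
      using reals_Archimedean[of "?b - \<theta>"] z by auto
    have "1 / real (Suc (max m k)) \<le> inverse (real (Suc k))"
      by (simp add: field_simps)
    then have "\<theta> \<le> ?b - 1 / real (Suc (max m k))" using k by linarith
    then have "(\<rho>, \<theta>) \<in> {0..real (max m k)} \<times> {?a..?b - 1 / real (Suc (max m k))}"
      using z m by auto
    then have "z \<in> ?K (max m k)"
      using z(1) by (intro image_eqI[of _ _ "(\<rho>, \<theta>)"]) auto
    then show "z \<in> (\<Union>n. ?K n)" by blast
  qed
  finally show ?thesis .
qed

text \<open>All sectors fit into the single full turn that begins at \<open>- (pi / real M)\<close>,
  the lower end of sector 0.\<close>

lemma psk_sector_window:
  assumes "l < M"
  shows "- (pi / real M) \<le> (2 * real l - 1) * pi / real M"
    and "(2 * real l + 1) * pi / real M \<le> - (pi / real M) + 2 * pi"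
proof -
  have M: "real M > 0" using assms by simp
  have "(2 * real l - 1) * pi / real M = - (pi / real M) + 2 * real l * (pi / real M)"
    using M by (simp add: field_simps)
  then show "- (pi / real M) \<le> (2 * real l - 1) * pi / real M" by simp
  have "(2 * real l + 2) * pi / real M \<le> 2 * pi"
    using assms M by (simp add: divide_le_eq flip: of_nat_Suc)
  moreover have "(2 * real l + 1) * pi / real M = (2 * real l + 2) * pi / real M - pi / real M"
    using M by (simp add: field_simps)
  ultimately show "(2 * real l + 1) * pi / real M \<le> - (pi / real M) + 2 * pi" by simp
qed

text \<open>Away from the origin a point has exactly one angle in a half-open window of length
  \<open>2 * pi\<close>, and the angles defining the sector lie in that window. Membership thus
  becomes a condition on \<open>\<theta>\<close> alone.\<close>

lemma polar_mem_psk_sector: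
  assumes M: "M \<ge> 2" "l < M" and \<rho>: "\<rho> > 0"
    and \<theta>: "- (pi / real M) \<le> \<theta>" "\<theta> < - (pi / real M) + 2 * pi"
  shows "of_real \<rho> * cis \<theta> \<in> psk_sector M l
    \<longleftrightarrow> (2 * real l - 1) * pi / real M \<le> \<theta> \<and> \<theta> < (2 * real l + 1) * pi / real M"
    (is "_ \<longleftrightarrow> ?a \<le> \<theta> \<and> \<theta> < ?b")
proof
  assume "of_real \<rho> * cis \<theta> \<in> psk_sector M l"
  then obtain r t where eq: "of_real \<rho> * cis \<theta> = of_real r * cis t" and r: "0 \<le> r" and t: "?a \<le> t" "t < ?b"
    unfolding psk_sector_def by blast
  have "cmod (of_real \<rho> * cis \<theta>) = cmod (of_real r * cis t)" by (simp only: eq)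
  then have "r = \<rho>" using \<rho> r by (simp add: norm_mult)
  then have "cis \<theta> = cis t" using eq \<rho> by simp
  then have "sin \<theta> = sin t \<and> cos \<theta> = cos t" by (simp add: complex_eq_iff)
  then obtain n :: int where n: "\<theta> = t + 2 * pi * n" using sin_cos_eq_iff by blast
  have "\<bar>\<theta> - t\<bar> < 2 * pi"
    using \<theta> t psk_sector_window[OF M(2)] by linarith
  then have "\<bar>2 * pi * real_of_int n\<bar> < 2 * pi" by (simp add: n)
  then have "\<bar>real_of_int n\<bar> < 1" by (simp add: abs_mult)
  then have "n = 0" by linarith
  then show "?a \<le> \<theta> \<and> \<theta> < ?b" using n t by simp
next
  assume "?a \<le> \<theta> \<and> \<theta> < ?b"
  then show "of_real \<rho> * cis \<theta> \<in> psk_sector M l"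
    unfolding psk_sector_def using \<rho> by (intro CollectI exI[of _ \<rho>] exI[of _ \<theta>]) auto
qed

text \<open>Substituting \<open>\<rho> = sqrt N0 * t\<close> removes the noise level, because signal
  amplitude and noise both scale with \<open>sqrt N0\<close>; only the ratio \<open>s\<close>
  remains.\<close>

lemma nn_integral_radial_scaled:
  assumes "N0 > 0" "s \<ge> 0"
  shows "(\<integral>\<^sup>+\<rho>. ennreal \<rho> * ennreal (1 / (pi * N0) *
           exp (- (cmod (of_real \<rho> * cis \<theta> - of_real (sqrt (s * N0))))\<^sup>2 / N0)) * indicator {0<..} \<rho> \<partial>lborel)
    = ennreal (angle_density (sqrt s) \<theta>)" (is "?L = _")
proof -
  define \<sigma> where "\<sigma> = sqrt N0"
  have \<sigma>: "\<sigma> > 0" "N0 = \<sigma>\<^sup>2" using assms by (simp_all add: \<sigma>_def)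
  have "?L = ennreal \<bar>\<sigma>\<bar> * (\<integral>\<^sup>+t. ennreal (0 + \<sigma> * t) * ennreal (1 / (pi * N0) *
           exp (- (cmod (of_real (0 + \<sigma> * t) * cis \<theta> - of_real (sqrt (s * N0))))\<^sup>2 / N0)) * indicator {0<..} (0 + \<sigma> * t) \<partial>lborel)"
    by (rule nn_integral_real_affine) (use \<sigma> in \<open>simp_all\<close>)
  also have "\<dots> = (\<integral>\<^sup>+t. ennreal \<sigma> * (ennreal (0 + \<sigma> * t) * ennreal (1 / (pi * N0) *
           exp (- (cmod (of_real (0 + \<sigma> * t) * cis \<theta> - of_real (sqrt (s * N0))))\<^sup>2 / N0)) * indicator {0<..} (0 + \<sigma> * t)) \<partial>lborel)"
    using \<sigma> by (subst nn_integral_cmult) simp_all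
  also have "\<dots> = (\<integral>\<^sup>+t. ennreal (t / pi * exp (- (cmod (of_real t * cis \<theta> - of_real (sqrt s)))\<^sup>2)) * indicator {0..} t \<partial>lborel)"
  proof (intro nn_integral_cong)
    fix t :: real
    show "ennreal \<sigma> * (ennreal (0 + \<sigma> * t) * ennreal (1 / (pi * N0) *
           exp (- (cmod (of_real (0 + \<sigma> * t) * cis \<theta> - of_real (sqrt (s * N0))))\<^sup>2 / N0)) * indicator {0<..} (0 + \<sigma> * t))
        = ennreal (t / pi * exp (- (cmod (of_real t * cis \<theta> - of_real (sqrt s)))\<^sup>2)) * indicator {0..} t"
    proof (cases "t > 0")
      case True
      have "of_real (0 + \<sigma> * t) * cis \<theta> - complex_of_real (sqrt (s * N0))
          = of_real \<sigma> * (of_real t * cis \<theta> - of_real (sqrt s))"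
        using \<sigma> by (simp add: real_sqrt_mult algebra_simps)
      then have "(cmod (of_real (0 + \<sigma> * t) * cis \<theta> - complex_of_real (sqrt (s * N0))))\<^sup>2 / N0
          = (cmod (of_real t * cis \<theta> - of_real (sqrt s)))\<^sup>2"
        using \<sigma> by (simp only: norm_mult) (simp add: power_mult_distrib)
      then show ?thesis
        using True \<sigma> by (simp add: ennreal_mult[symmetric] power2_eq_square)
    next
      case False
      \<comment> \<open>At \<open>t = 0\<close> the two indicators differ, but the factor
        \<open>t\<close> vanishes.\<close>
      then show ?thesis using \<sigma> by (cases "t = 0") (auto simp: zero_less_mult_iff)
    qed
  qed
  also have "\<dots> = ennreal (angle_density (sqrt s) \<theta>)"
    by (rule nn_integral_radial)
  finally show ?thesis .
qed

text \<open>In polar coordinates the sector is an interval of angles, and the radial integral is the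
  angular density. Symbol 0 is sent on the nonnegative real axis, as the radial formulas
  presuppose.\<close>

theorem psk_prob_0:
  assumes M: "M \<ge> 2" "l < M" and N0: "N0 > 0" and s: "s \<ge> 0"
  shows "psk_prob M (s * N0) N0 l 0
    = integral {(2 * real l - 1) * pi / real M..(2 * real l + 1) * pi / real M} (angle_density (sqrt s))"
    (is "_ = integral {?a..?b} _")
proof -
  note [measurable] = psk_sector_borel[of M l]
  let ?d = "\<lambda>z. ennreal (1 / (pi * N0) * exp (- (cmod (z - of_real (sqrt (s * N0))))\<^sup>2 / N0))"
  let ?w = "- (pi / real M)"
  have w: "- (pi / 2) \<le> ?w" "?w \<le> pi / 2"
  proof -
    have "pi / real M \<le> pi / 2" "0 \<le> pi / real M"
      using M by (auto intro: divide_left_mono[of 2 "real M" pi, simplified])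
    then show "- (pi / 2) \<le> ?w" "?w \<le> pi / 2"
      using pi_gt_zero by linarith+
  qed
  note window = psk_sector_window[OF M(2)]
  have "emeasure (psk_received M (s * N0) N0 0) (psk_sector M l)
      = (\<integral>\<^sup>+z. ?d z * indicator (psk_sector M l) z \<partial>lborel)"
    unfolding psk_received_def by (simp add: emeasure_density psk_signal_def)
  also have "\<dots> = (\<integral>\<^sup>+\<theta>. (\<integral>\<^sup>+\<rho>. ennreal \<rho> * (?d (of_real \<rho> * cis \<theta>) * indicator (psk_sector M l) (of_real \<rho> * cis \<theta>))
      * indicator {0<..} \<rho> \<partial>lborel) * indicator {?w..<?w + 2 * pi} \<theta> \<partial>lborel)"
    by (rule nn_integral_polar[OF _ w]) measurable
  also have "\<dots> = (\<integral>\<^sup>+\<theta>. ennreal (angle_density (sqrt s) \<theta>) * indicator {?a..?b} \<theta> \<partial>lborel)"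
  \<comment> \<open>The sector is half-open in the angle while the target interval is closed; the
    endpoint \<open>?b\<close> is a null set.\<close>
  proof (intro nn_integral_cong_AE, use AE_lborel_singleton[of ?b] in eventually_elim)
    fix \<theta> :: real assume ne: "\<theta> \<noteq> ?b"
    have "(\<integral>\<^sup>+\<rho>. ennreal \<rho> * (?d (of_real \<rho> * cis \<theta>) * indicator (psk_sector M l) (of_real \<rho> * cis \<theta>))
        * indicator {0<..} \<rho> \<partial>lborel) = ennreal (angle_density (sqrt s) \<theta>) * indicator {?a..?b} \<theta>"
      if \<theta>: "\<theta> \<in> {?w..<?w + 2 * pi}"
    proof -
      have "(\<integral>\<^sup>+\<rho>. ennreal \<rho> * (?d (of_real \<rho> * cis \<theta>) * indicator (psk_sector M l) (of_real \<rho> * cis \<theta>))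
          * indicator {0<..} \<rho> \<partial>lborel)
          = (\<integral>\<^sup>+\<rho>. ennreal \<rho> * ?d (of_real \<rho> * cis \<theta>) * indicator {0<..} \<rho> * indicator {?a..?b} \<theta> \<partial>lborel)"
      proof (intro nn_integral_cong)
        fix \<rho> :: real
        show "ennreal \<rho> * (?d (of_real \<rho> * cis \<theta>) * indicator (psk_sector M l) (of_real \<rho> * cis \<theta>)) * indicator {0<..} \<rho>
            = ennreal \<rho> * ?d (of_real \<rho> * cis \<theta>) * indicator {0<..} \<rho> * indicator {?a..?b} \<theta>"
          using polar_mem_psk_sector[OF M, of \<rho> \<theta>] \<theta> ne
          by (cases "\<rho> > 0") (auto simp: indicator_def)
      qed
      also have "\<dots> = ennreal (angle_density (sqrt s) \<theta>) * indicator {?a..?b} \<theta>"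
        by (subst nn_integral_multc) (simp_all only: nn_integral_radial_scaled[OF N0 s], measurable)
      finally show ?thesis .
    qed
    then show "(\<integral>\<^sup>+\<rho>. ennreal \<rho> * (?d (of_real \<rho> * cis \<theta>) * indicator (psk_sector M l) (of_real \<rho> * cis \<theta>))
        * indicator {0<..} \<rho> \<partial>lborel) * indicator {?w..<?w + 2 * pi} \<theta>
        = ennreal (angle_density (sqrt s) \<theta>) * indicator {?a..?b} \<theta>"
      using window ne by (auto split: split_indicator)
  qed
  also have "\<dots> = ennreal (integral {?a..?b} (angle_density (sqrt s)))"
    by (intro nn_integral_has_integral_lebesgue' integrable_integral integrable_continuous_interval
        continuous_intros less_imp_le angle_density_pos)
  finally show ?thesis
    unfolding psk_prob_def measure_def
    by (simp add: integral_nonneg integrable_continuous_interval continuous_intros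
        less_imp_le angle_density_pos)
qed

section \<open>Small-signal expansions\<close>

text \<open>Divided by \<open>pi\<close>, this is \<open>sin \<theta>\<close> times the integral of
  the Gaussian density along the ray of angle \<open>\<theta>\<close>: the rate at which mass
  crosses the ray towards smaller angles while the signal moves in the positive real
  direction.\<close>

definition ray_flux :: "real \<Rightarrow> real \<Rightarrow> real" where
  "ray_flux x \<theta> = sin \<theta> * exp (- (x * sin \<theta>)\<^sup>2) * gauss_cdf (x * cos \<theta>)"

text \<open>The common value of the \<open>\<theta>\<close>-derivative of \<open>ray_flux\<close>
  and \<open>pi\<close> times the \<open>x\<close>-derivative of
  \<open>angle_density\<close>.\<close>

definition ray_flux_deriv :: "real \<Rightarrow> real \<Rightarrow> real" where
  "ray_flux_deriv x \<theta> = cos \<theta> * exp (- (x * sin \<theta>)\<^sup>2) * gauss_cdf (x * cos \<theta>) * (1 - 2 * (x * sin \<theta>)\<^sup>2)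
     - x * (sin \<theta>)\<^sup>2 * exp (- x\<^sup>2)"

lemma exp_minus_square_split:
  "exp (- (x * sin \<theta>)\<^sup>2) * exp (- (x * cos \<theta>)\<^sup>2) = exp (- x\<^sup>2)" for x \<theta> :: real
proof -
  have "x\<^sup>2 = (x * sin \<theta>)\<^sup>2 + (x * cos \<theta>)\<^sup>2"
    by (simp add: power_mult_distrib flip: distrib_left)
  then show ?thesis by (simp flip: exp_add)
qed

lemma DERIV_ray_flux: "(ray_flux x has_real_derivative ray_flux_deriv x \<theta>) (at \<theta>)"
proof -
  let ?e = "exp (- (x * sin \<theta>)\<^sup>2)" and ?k = "exp (- (x * cos \<theta>)\<^sup>2)" and ?g = "gauss_cdf (x * cos \<theta>)"
  have "(ray_flux x has_real_derivative
      cos \<theta> * ?e * ?g - sin \<theta> * (?e * (2 * (x * sin \<theta>) * (x * cos \<theta>))) * ?g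
        - x * (sin \<theta>)\<^sup>2 * (?e * ?k)) (at \<theta>)"
    unfolding ray_flux_def
    by (auto intro!: derivative_eq_intros simp: power2_eq_square algebra_simps)
  then show ?thesis
    unfolding ray_flux_deriv_def exp_minus_square_split
    by (simp add: power2_eq_square algebra_simps)
qed

text \<open>The conservation law. The two terms with \<open>exp (- x\<^sup>2)\<close> merge because
  \<open>(cos \<theta>)\<^sup>2 - 1 = - (sin \<theta>)\<^sup>2\<close>, which leaves the angular
  derivative of the flux.\<close>

lemma DERIV_angle_density:
  "((\<lambda>x. angle_density x \<theta>) has_real_derivative ray_flux_deriv x \<theta> / pi) (at x)"
proof -
  let ?e = "exp (- (x * sin \<theta>)\<^sup>2)" and ?k = "exp (- (x * cos \<theta>)\<^sup>2)" and ?g = "gauss_cdf (x * cos \<theta>)"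
  have "((\<lambda>x. angle_density x \<theta>) has_real_derivative
      - (x * exp (- x\<^sup>2)) / pi + (cos \<theta> * ?e * ?g - x * cos \<theta> * (?e * (2 * (x * sin \<theta>) * sin \<theta>)) * ?g
        + x * (cos \<theta>)\<^sup>2 * (?e * ?k)) / pi) (at x)"
    unfolding angle_density_def
    by (auto intro!: derivative_eq_intros simp: power2_eq_square field_simps)
  also have "- (x * exp (- x\<^sup>2)) / pi + (cos \<theta> * ?e * ?g - x * cos \<theta> * (?e * (2 * (x * sin \<theta>) * sin \<theta>)) * ?g
        + x * (cos \<theta>)\<^sup>2 * (?e * ?k)) / pi = ray_flux_deriv x \<theta> / pi"
    unfolding ray_flux_deriv_def exp_minus_square_split cos_squared_eq
    by (simp add: power2_eq_square field_simps)
  finally show ?thesis .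
qed

text \<open>Differentiation under the integral sign produces an exact angular derivative, so only
  the fluxes at the two ends remain.\<close>

lemma DERIV_integral_angle_density:
  assumes "a \<le> b"
  shows "((\<lambda>x. integral {a..b} (angle_density x)) has_real_derivative
    (ray_flux x b - ray_flux x a) / pi) (at x)"
proof -
  have "((\<lambda>x. integral (cbox a b) (angle_density x)) has_real_derivative
      integral (cbox a b) (\<lambda>\<theta>. ray_flux_deriv x \<theta> / pi)) (at x within UNIV)"
    unfolding ray_flux_deriv_def
    by (intro leibniz_rule_field_derivative DERIV_angle_density[unfolded ray_flux_deriv_def] integrable_continuous continuous_intros)
      (auto simp: case_prod_unfold intro!: continuous_intros)
  moreover have "((\<lambda>\<theta>. ray_flux_deriv x \<theta> / pi) has_integral ray_flux x b / pi - ray_flux x a / pi) {a..b}"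
    using assms
    by (intro fundamental_theorem_of_calculus)
      (auto intro!: derivative_eq_intros has_field_derivative_at_within[OF DERIV_ray_flux]
        simp flip: has_real_derivative_iff_has_vector_derivative)
  ultimately show ?thesis
    by (simp only: cbox_interval integral_unique diff_divide_distrib)
qed

lemma exp_minus_square_limit:
  "((\<lambda>x. (exp (- (x * c)\<^sup>2) - 1) / x\<^sup>2) \<longlongrightarrow> - c\<^sup>2) (at_right 0)" for c :: real
proof (cases "c = 0")
  case False
  then have "c\<^sup>2 > 0" by simp
  then show ?thesis unfolding power_mult_distrib by real_asymp
qed simp

text \<open>The quadratic term comes from the exponential alone: \<open>gauss_cdf\<close> has none
  at \<open>0\<close>, because its derivative is even.\<close>

lemma ray_flux_expansion:
  "((\<lambda>x. (ray_flux x \<theta> - sqrt pi / 2 * sin \<theta> - sin \<theta> * cos \<theta> * x) / x\<^sup>2)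
    \<longlongrightarrow> - (sqrt pi / 2 * (sin \<theta>) ^ 3)) (at_right 0)"
proof -
  define \<alpha> where "\<alpha> x = (exp (- (x * sin \<theta>)\<^sup>2) - 1) / x\<^sup>2" for x
  define \<beta> where "\<beta> x = (gauss_cdf (x * cos \<theta>) - sqrt pi / 2 - x * cos \<theta>) / x\<^sup>2" for x
  have cont: "isCont gauss_cdf y" for y
    by (rule DERIV_isCont[OF DERIV_gauss_cdf])
  have g: "((\<lambda>x. gauss_cdf (x * cos \<theta>)) \<longlongrightarrow> sqrt pi / 2) (at_right 0)"
    by (rule tendsto_eq_rhs[OF isCont_tendsto_compose[OF cont]]) (auto intro!: tendsto_eq_intros)
  have \<alpha>: "(\<alpha> \<longlongrightarrow> - (sin \<theta>)\<^sup>2) (at_right 0)"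
    unfolding \<alpha>_def by (rule exp_minus_square_limit)
  have \<beta>: "(\<beta> \<longlongrightarrow> 0) (at_right 0)"
    unfolding \<beta>_def
  proof (rule lhopital_right_0)
    have "((\<lambda>x. gauss_cdf (x * cos \<theta>) - sqrt pi / 2 - x * cos \<theta>)
        \<longlongrightarrow> sqrt pi / 2 - sqrt pi / 2 - 0 * cos \<theta>) (at_right 0)"
      by (intro tendsto_intros g)
    then show "((\<lambda>x. gauss_cdf (x * cos \<theta>) - sqrt pi / 2 - x * cos \<theta>) \<longlongrightarrow> 0) (at_right 0)"
      by simp
    show "\<forall>\<^sub>F x in at_right 0. ((\<lambda>x. gauss_cdf (x * cos \<theta>) - sqrt pi / 2 - x * cos \<theta>)
        has_real_derivative (exp (- (x * cos \<theta>)\<^sup>2) * cos \<theta> - cos \<theta>)) (at x)"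
      by (intro always_eventually allI) (auto intro!: derivative_eq_intros)
    show "\<forall>\<^sub>F x in at_right 0. ((\<lambda>x. x\<^sup>2) has_real_derivative 2 * x) (at (x::real))"
      by (intro always_eventually allI) (auto intro!: derivative_eq_intros)
    have "((\<lambda>x. (exp (- (x * cos \<theta>)\<^sup>2) - 1) / x\<^sup>2 * (x * cos \<theta> / 2))
        \<longlongrightarrow> - (cos \<theta>)\<^sup>2 * (0 * cos \<theta> / 2)) (at_right 0)"
      by (intro tendsto_intros exp_minus_square_limit) simp
    then show "((\<lambda>x. (exp (- (x * cos \<theta>)\<^sup>2) * cos \<theta> - cos \<theta>) / (2 * x)) \<longlongrightarrow> 0) (at_right 0)"
      by (rule filterlim_cong[THEN iffD1, rotated -1])
        (auto simp: eventually_at_filter power2_eq_square field_simps)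
  qed (auto intro!: tendsto_eq_intros simp: eventually_at_filter)
  \<comment> \<open>With \<open>e\<close> and \<open>g\<close> for the exponential and the
    \<open>gauss_cdf\<close> factor, \<open>e * g - sqrt pi / 2 - x * cos \<theta>\<close> is
    \<open>(e - 1) * g\<close> plus the remainder of \<open>g\<close>.\<close>
  have "((\<lambda>x. sin \<theta> * (\<beta> x + \<alpha> x * gauss_cdf (x * cos \<theta>)))
      \<longlongrightarrow> sin \<theta> * (0 + - (sin \<theta>)\<^sup>2 * (sqrt pi / 2))) (at_right 0)"
    by (intro tendsto_intros \<alpha> \<beta> g)
  also have "sin \<theta> * (0 + - (sin \<theta>)\<^sup>2 * (sqrt pi / 2)) = - (sqrt pi / 2 * (sin \<theta>) ^ 3)"
    by (simp add: power2_eq_square power3_eq_cube)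
  finally show ?thesis
  proof (rule filterlim_cong[THEN iffD1, rotated -1])
    show "\<forall>\<^sub>F x in at_right 0. sin \<theta> * (\<beta> x + \<alpha> x * gauss_cdf (x * cos \<theta>))
        = (ray_flux x \<theta> - sqrt pi / 2 * sin \<theta> - sin \<theta> * cos \<theta> * x) / x\<^sup>2"
      using eventually_at_right_less[of 0]
      by eventually_elim (simp add: \<alpha>_def \<beta>_def ray_flux_def field_simps)
  qed simp_all
qed

text \<open>Only the first three Taylor coefficients of \<open>q - 1\<close> enter, since \<open>ln q\<close> vanishes to first
  order.\<close>

lemma entropy_derivative_expansion:
  fixes q q' :: "real \<Rightarrow> real"
  assumes deriv: "\<And>x. (q has_real_derivative q' x) (at x)" and q0: "q 0 = 1"
    and lim: "((\<lambda>x. (q' x - b1 - 2 * b2 * x) / x\<^sup>2) \<longlongrightarrow> 3 * b3) (at_right 0)"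
  shows "((\<lambda>x. (q' x * ln (q x) - b1\<^sup>2 * x - (3 * b1 * b2 - b1 ^ 3 / 2) * x\<^sup>2) / x ^ 3)
    \<longlongrightarrow> 4 * b1 * b3 - 2 * b1\<^sup>2 * b2 + b1 ^ 4 / 3 + 2 * b2\<^sup>2) (at_right 0)"
proof -
  \<comment> \<open>\<open>d\<close>, \<open>v\<close> and \<open>\<eta>\<close> are the scaled
    remainders of \<open>q'\<close>, \<open>q\<close> and \<open>ln (1 + y)\<close>; for
    \<open>x > 0\<close>, \<open>u x\<close> is \<open>(q x - 1) / x\<close>, and \<open>R\<close>
    is the scaled remainder of \<open>ln (q x) / x\<close>. The value \<open>1 / 3\<close> makes
    \<open>\<eta>\<close> continuous at \<open>0\<close>, a point that \<open>q x - 1\<close> may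
    hit.\<close>
  define d where "d x = (q' x - b1 - 2 * b2 * x) / x\<^sup>2" for x
  define v where "v x = (q x - 1 - b1 * x - b2 * x\<^sup>2) / x ^ 3" for x
  define \<eta> where "\<eta> y = (if y = 0 then 1 / 3 else (ln (1 + y) - y + y\<^sup>2 / 2) / y ^ 3)" for y :: real
  define u where "u x = b1 + b2 * x + v x * x\<^sup>2" for x
  define R where "R x = v x - (b2 + v x * x) * (2 * b1 + x * (b2 + v x * x)) / 2 + \<eta> (q x - 1) * u x ^ 3" for x
  have q_lim: "(q \<longlongrightarrow> 1) (at_right 0)"
    using DERIV_isCont[OF deriv, of 0] q0 by (auto simp: isCont_def intro: filterlim_mono at_le)
  have d: "(d \<longlongrightarrow> 3 * b3) (at_right 0)"
    using lim by (simp add: d_def[abs_def])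
  have x0: "((\<lambda>x::real. x) \<longlongrightarrow> 0) (at_right 0)"
    by (rule tendsto_ident_at)
  \<comment> \<open>Only \<open>q'\<close> is assumed to have an expansion; l'Hopital's rule carries
    it over to \<open>q\<close>.\<close>
  have v: "(v \<longlongrightarrow> b3) (at_right 0)"
    unfolding v_def
  proof (rule lhopital_right_0)
    show "((\<lambda>x. q x - 1 - b1 * x - b2 * x\<^sup>2) \<longlongrightarrow> 0) (at_right 0)"
      by (rule tendsto_eq_intros q_lim | simp)+
    show "\<forall>\<^sub>F x in at_right 0. ((\<lambda>x. q x - 1 - b1 * x - b2 * x\<^sup>2)
        has_real_derivative (q' x - b1 - 2 * b2 * x)) (at x)"
      by (intro always_eventually allI) (auto intro!: derivative_eq_intros deriv)
    show "\<forall>\<^sub>F x in at_right 0. ((\<lambda>x. x ^ 3) has_real_derivative 3 * x\<^sup>2) (at (x::real))"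
      by (intro always_eventually allI) (auto intro!: derivative_eq_intros)
    have "((\<lambda>x. d x / 3) \<longlongrightarrow> 3 * b3 / 3) (at_right 0)"
      by (intro tendsto_intros d) simp
    then show "((\<lambda>x. (q' x - b1 - 2 * b2 * x) / (3 * x\<^sup>2)) \<longlongrightarrow> b3) (at_right 0)"
      by (simp add: d_def mult.commute)
  qed (auto intro!: tendsto_eq_intros simp: eventually_at_filter)
  have "((\<lambda>y::real. (ln (1 + y) - y + y\<^sup>2 / 2) / y ^ 3) \<longlongrightarrow> 1 / 3) (at 0)"
    by real_asymp
  then have "isCont \<eta> 0"
    unfolding isCont_def by (rule filterlim_cong[THEN iffD1, rotated -1])
      (auto simp: \<eta>_def eventually_at_filter)
  then have \<eta>: "((\<lambda>x. \<eta> (q x - 1)) \<longlongrightarrow> 1 / 3) (at_right 0)"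
    by (rule tendsto_eq_rhs[OF isCont_tendsto_compose])
      (auto intro!: tendsto_eq_intros q_lim simp: \<eta>_def)
  have u: "(u \<longlongrightarrow> b1) (at_right 0)"
    unfolding u_def by (rule tendsto_eq_intros v x0 | simp)+
  have "(R \<longlongrightarrow> b3 - (b2 + b3 * 0) * (2 * b1 + 0 * (b2 + b3 * 0)) / 2 + 1 / 3 * b1 ^ 3) (at_right 0)"
    unfolding R_def by (intro tendsto_intros v x0 u \<eta>) simp
  then have R: "(R \<longlongrightarrow> b3 - b1 * b2 + b1 ^ 3 / 3) (at_right 0)"
    by (simp add: mult.commute)
  \<comment> \<open>This is the product of the expansions of \<open>q' x\<close> and
    \<open>ln (q x) / x\<close>, with the constant and linear terms removed and the rest divided by
    \<open>x\<^sup>2\<close>.\<close>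
  have "((\<lambda>x. b1 * R x + 2 * b2 * (b2 - b1\<^sup>2 / 2 + x * R x)
        + d x * (b1 + x * (b2 - b1\<^sup>2 / 2) + x\<^sup>2 * R x))
      \<longlongrightarrow> b1 * (b3 - b1 * b2 + b1 ^ 3 / 3) + 2 * b2 * (b2 - b1\<^sup>2 / 2 + 0 * (b3 - b1 * b2 + b1 ^ 3 / 3))
        + 3 * b3 * (b1 + 0 * (b2 - b1\<^sup>2 / 2) + 0\<^sup>2 * (b3 - b1 * b2 + b1 ^ 3 / 3))) (at_right 0)"
    by (intro tendsto_intros R d)
  also have "b1 * (b3 - b1 * b2 + b1 ^ 3 / 3) + 2 * b2 * (b2 - b1\<^sup>2 / 2 + 0 * (b3 - b1 * b2 + b1 ^ 3 / 3))
        + 3 * b3 * (b1 + 0 * (b2 - b1\<^sup>2 / 2) + 0\<^sup>2 * (b3 - b1 * b2 + b1 ^ 3 / 3))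
      = 4 * b1 * b3 - 2 * b1\<^sup>2 * b2 + b1 ^ 4 / 3 + 2 * b2\<^sup>2"
    by (simp add: power2_eq_square power3_eq_cube power4_eq_xxxx algebra_simps)
  finally show ?thesis
  proof (rule filterlim_cong[THEN iffD1, rotated -1])
    show "\<forall>\<^sub>F x in at_right 0. b1 * R x + 2 * b2 * (b2 - b1\<^sup>2 / 2 + x * R x)
        + d x * (b1 + x * (b2 - b1\<^sup>2 / 2) + x\<^sup>2 * R x)
      = (q' x * ln (q x) - b1\<^sup>2 * x - (3 * b1 * b2 - b1 ^ 3 / 2) * x\<^sup>2) / x ^ 3"
      using eventually_at_right_less[of 0]
    proof eventually_elim
      fix x :: real assume x: "x > 0"
      have q: "q x - 1 = x * u x"
        using x by (simp add: u_def v_def power2_eq_square power3_eq_cube field_simps)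
      have q': "q' x = b1 + 2 * b2 * x + d x * x\<^sup>2"
        using x by (simp add: d_def)
      have "ln (1 + y) = y - y\<^sup>2 / 2 + \<eta> y * y ^ 3" for y
        by (simp add: \<eta>_def)
      from this[of "q x - 1"]
      have "ln (q x) = x * u x - (x * u x)\<^sup>2 / 2 + \<eta> (q x - 1) * (x * u x) ^ 3"
        by (simp flip: q)
      also have "\<dots> = x * (b1 + x * (b2 - b1\<^sup>2 / 2) + x\<^sup>2 * R x)"
        unfolding R_def by (simp add: u_def power2_eq_square power3_eq_cube algebra_simps)
      finally have lnq: "ln (q x) = x * (b1 + x * (b2 - b1\<^sup>2 / 2) + x\<^sup>2 * R x)" .
      show "b1 * R x + 2 * b2 * (b2 - b1\<^sup>2 / 2 + x * R x)
          + d x * (b1 + x * (b2 - b1\<^sup>2 / 2) + x\<^sup>2 * R x)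
        = (q' x * ln (q x) - b1\<^sup>2 * x - (3 * b1 * b2 - b1 ^ 3 / 2) * x\<^sup>2) / x ^ 3"
        unfolding q' lnq using x by (simp add: power2_eq_square power3_eq_cube field_simps)
    qed
  qed simp_all
qed

section \<open>Differentiating the capacity\<close>

text \<open>The derivative of the capacity in \<open>s\<close>, where \<open>q l\<close> stands for
  \<open>M\<close> times the probability of output \<open>l\<close> as a function of
  \<open>sqrt s\<close>. At \<open>s = 0\<close> the quotient would be zero through division by
  zero, so its limit is inserted there.\<close>

definition entropy_slope :: "nat \<Rightarrow> (nat \<Rightarrow> real) \<Rightarrow> (nat \<Rightarrow> real \<Rightarrow> real) \<Rightarrow> (nat \<Rightarrow> real \<Rightarrow> real) \<Rightarrow> real \<Rightarrow> real" where
  "entropy_slope M b1 q q' s = (if s = 0 then (\<Sum>l<M. (b1 l)\<^sup>2) / (2 * real M)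
     else (\<Sum>l<M. q' l (sqrt s) * ln (q l (sqrt s))) / (2 * real M * sqrt s))"

lemma DERIV_mult_ln:
  assumes "(f has_real_derivative d) (at x)" "f x > 0"
  shows "((\<lambda>x. f x * ln (f x)) has_real_derivative d * ln (f x) + d) (at x)"
  using DERIV_mult[OF assms(1) DERIV_chain2[OF DERIV_ln[OF assms(2)] assms(1)]] assms(2)
  by (simp add: algebra_simps)

section \<open>Entropy of a family of distributions near the uniform one\<close>

context
  fixes M :: nat and q q' :: "nat \<Rightarrow> real \<Rightarrow> real" and b1 b2 b3 :: "nat \<Rightarrow> real"
  assumes M: "M > 0"
    and deriv: "\<And>l x. l < M \<Longrightarrow> (q l has_real_derivative q' l x) (at x)"
    and q0: "\<And>l. l < M \<Longrightarrow> q l 0 = 1"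
    and pos: "\<And>l x. l < M \<Longrightarrow> q l x > 0"
    and sum_deriv: "\<And>x. (\<Sum>l<M. q' l x) = 0"
    and lim: "\<And>l. l < M \<Longrightarrow> ((\<lambda>x. (q' l x - b1 l - 2 * b2 l * x) / x\<^sup>2) \<longlongrightarrow> 3 * b3 l) (at_right 0)"
begin

text \<open>The expansions for the single outputs at \<open>x = sqrt s\<close> are summed and
  divided by \<open>2 * real M * x\<close>. Linear coefficients give the value at \<open>0\<close>,
  quadratic ones a term of order \<open>1 / sqrt s\<close> in the difference quotient, cubic ones
  its finite part.\<close>

lemma entropy_slope_expansion:
  "((\<lambda>s. (entropy_slope M b1 q q' s - entropy_slope M b1 q q' 0) / s
      - (\<Sum>l<M. 3 * b1 l * b2 l - b1 l ^ 3 / 2) / (2 * real M * sqrt s))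
    \<longlongrightarrow> (\<Sum>l<M. 4 * b1 l * b3 l - 2 * (b1 l)\<^sup>2 * b2 l + b1 l ^ 4 / 3 + 2 * (b2 l)\<^sup>2) / (2 * real M))
    (at_right 0)"
proof -
  let ?e = "\<lambda>l x. (q' l x * ln (q l x) - (b1 l)\<^sup>2 * x - (3 * b1 l * b2 l - b1 l ^ 3 / 2) * x\<^sup>2) / x ^ 3"
  have "filterlim sqrt (at_right 0) (at_right 0)"
    by real_asymp
  moreover have "((\<lambda>x. (\<Sum>l<M. ?e l x) / (2 * real M)) \<longlongrightarrow>
      (\<Sum>l<M. 4 * b1 l * b3 l - 2 * (b1 l)\<^sup>2 * b2 l + b1 l ^ 4 / 3 + 2 * (b2 l)\<^sup>2) / (2 * real M)) (at_right 0)"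
    using M by (intro tendsto_intros entropy_derivative_expansion deriv q0 lim) auto
  ultimately have "((\<lambda>s. (\<Sum>l<M. ?e l (sqrt s)) / (2 * real M)) \<longlongrightarrow>
      (\<Sum>l<M. 4 * b1 l * b3 l - 2 * (b1 l)\<^sup>2 * b2 l + b1 l ^ 4 / 3 + 2 * (b2 l)\<^sup>2) / (2 * real M)) (at_right 0)"
    by (rule filterlim_compose[rotated])
  then show ?thesis
  proof (rule filterlim_cong[THEN iffD1, rotated -1])
    show "\<forall>\<^sub>F s in at_right 0. (\<Sum>l<M. ?e l (sqrt s)) / (2 * real M)
      = (entropy_slope M b1 q q' s - entropy_slope M b1 q q' 0) / s
        - (\<Sum>l<M. 3 * b1 l * b2 l - b1 l ^ 3 / 2) / (2 * real M * sqrt s)"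
      using eventually_at_right_less[of 0]
    proof eventually_elim
      fix s :: real assume s: "s > 0"
      define x where "x = sqrt s"
      have x: "x > 0" "s = x\<^sup>2" using s by (simp_all add: x_def)
      have "(\<Sum>l<M. ?e l x) = ((\<Sum>l<M. q' l x * ln (q l x)) - (\<Sum>l<M. (b1 l)\<^sup>2) * x
          - (\<Sum>l<M. 3 * b1 l * b2 l - b1 l ^ 3 / 2) * x\<^sup>2) / x ^ 3"
        by (simp only: sum_divide_distrib sum_subtractf sum_distrib_right diff_divide_distrib left_diff_distrib)
      then have "(\<Sum>l<M. ?e l (sqrt s)) = ((\<Sum>l<M. q' l x * ln (q l x)) - (\<Sum>l<M. (b1 l)\<^sup>2) * x
          - (\<Sum>l<M. 3 * b1 l * b2 l - b1 l ^ 3 / 2) * x\<^sup>2) / x ^ 3"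
        by (simp only: x_def)
      moreover have "entropy_slope M b1 q q' s = (\<Sum>l<M. q' l x * ln (q l x)) / (2 * real M * x)"
        using s by (simp add: entropy_slope_def x_def)
      moreover have "entropy_slope M b1 q q' 0 = (\<Sum>l<M. (b1 l)\<^sup>2) / (2 * real M)"
        by (simp add: entropy_slope_def)
      moreover have "sqrt s = x" by (simp add: x_def)
      moreover have "(A - B * x - D * x\<^sup>2) / x ^ 3 / (2 * real M)
          = (A / (2 * real M * x) - B / (2 * real M)) / x\<^sup>2 - D / (2 * real M * x)" for A B D
        using x M by (simp add: power2_eq_square power3_eq_cube divide_simps)
      ultimately show "(\<Sum>l<M. ?e l (sqrt s)) / (2 * real M)
        = (entropy_slope M b1 q q' s - entropy_slope M b1 q q' 0) / s
          - (\<Sum>l<M. 3 * b1 l * b2 l - b1 l ^ 3 / 2) / (2 * real M * sqrt s)"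
        using x(2) by (simp only:)
    qed
  qed simp_all
qed

text \<open>Multiplied by \<open>s\<close>, the singular term of the expansion becomes a multiple of
  \<open>sqrt s\<close> and vanishes in the limit.\<close>

lemma entropy_slope_tendsto:
  "(entropy_slope M b1 q q' \<longlongrightarrow> entropy_slope M b1 q q' 0) (at_right 0)"
proof -
  let ?c = "(\<Sum>l<M. 3 * b1 l * b2 l - b1 l ^ 3 / 2) / (2 * real M)"
  let ?E = "\<lambda>s. (entropy_slope M b1 q q' s - entropy_slope M b1 q q' 0) / s
      - (\<Sum>l<M. 3 * b1 l * b2 l - b1 l ^ 3 / 2) / (2 * real M * sqrt s)"
  have s0: "((\<lambda>s::real. s) \<longlongrightarrow> 0) (at_right 0)" by (rule tendsto_ident_at)
  have "((\<lambda>s. entropy_slope M b1 q q' 0 + ?E s * s + ?c * sqrt s) \<longlongrightarrow>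
      entropy_slope M b1 q q' 0 +
      (\<Sum>l<M. 4 * b1 l * b3 l - 2 * (b1 l)\<^sup>2 * b2 l + b1 l ^ 4 / 3 + 2 * (b2 l)\<^sup>2) / (2 * real M) * 0
      + ?c * sqrt 0) (at_right 0)"
    by (intro tendsto_add tendsto_mult tendsto_const entropy_slope_expansion tendsto_real_sqrt s0)
  then have "((\<lambda>s. entropy_slope M b1 q q' 0 + ?E s * s + ?c * sqrt s)
      \<longlongrightarrow> entropy_slope M b1 q q' 0) (at_right 0)"
    by simp
  then show ?thesis
  proof (rule filterlim_cong[THEN iffD1, rotated -1])
    show "\<forall>\<^sub>F s in at_right 0. entropy_slope M b1 q q' 0 + ?E s * s + ?c * sqrt s
        = entropy_slope M b1 q q' s"
      using eventually_at_right_less[of 0]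
    proof eventually_elim
      fix s :: real assume s: "s > 0"
      have e: "A / (2 * real M * sqrt s) * s = A / (2 * real M) * sqrt s" for A
      proof -
        have "A / (2 * real M * r) * (r * r) = A / (2 * real M) * r" if "r > 0" for r
          using that M by (simp add: field_simps)
        from this[of "sqrt s"] show ?thesis using s by simp
      qed
      have "(X - Y) / s * s = X - Y" for X Y
        using s by simp
      then show "entropy_slope M b1 q q' 0 + ?E s * s + ?c * sqrt s = entropy_slope M b1 q q' s"
        by (simp only: left_diff_distrib[of _ _ s] e)
    qed
  qed simp_all
qed

text \<open>For \<open>s > 0\<close> this is the chain rule. At \<open>s = 0\<close> the square root
  has no finite derivative, so the right derivative is obtained by l'Hopital's rule from the limit
  of the slope.\<close>

lemma DERIV_entropy:
  assumes "s \<ge> 0"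
  shows "((\<lambda>s. ln (real M) + (\<Sum>l<M. q l (sqrt s) / real M * ln (q l (sqrt s) / real M)))
    has_real_derivative entropy_slope M b1 q q' s) (at s within {0..})"
    (is "(?K has_real_derivative _) _")
proof -
  have pos_case: "(?K has_real_derivative entropy_slope M b1 q q' s) (at s)" if s: "s > 0" for s
  proof -
    have "((\<lambda>s. q l (sqrt s) / real M * ln (q l (sqrt s) / real M)) has_real_derivative
        (q' l (sqrt s) * ln (q l (sqrt s)) + q' l (sqrt s) * (1 - ln (real M))) / (2 * real M * sqrt s)) (at s)"
      if l: "l < M" for l
    proof -
      define d where "d = q' l (sqrt s) * (inverse (sqrt s) / 2) / real M"
      have "((\<lambda>s. q l (sqrt s) / real M) has_real_derivative d) (at s)"
        unfolding d_def by (intro DERIV_cdivide DERIV_chain2[OF deriv[OF l] DERIV_real_sqrt[OF s]])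
      then have D: "((\<lambda>s. q l (sqrt s) / real M * ln (q l (sqrt s) / real M)) has_real_derivative
          d * ln (q l (sqrt s) / real M) + d) (at s)"
        using pos[OF l] M by (intro DERIV_mult_ln) simp_all
      have "ln (q l (sqrt s) / real M) = ln (q l (sqrt s)) - ln (real M)"
        using pos[OF l, of "sqrt s"] M by (simp add: ln_divide_pos)
      moreover have d: "d = q' l (sqrt s) / (2 * real M * sqrt s)"
        using s M by (simp add: d_def field_simps)
      moreover have "p / c * (L - m) + p / c = (p * L + p * (1 - m)) / c" for p c L m :: real
        by (simp add: add_divide_distrib diff_divide_distrib right_diff_distrib)
      ultimately have "d * ln (q l (sqrt s) / real M) + d
          = (q' l (sqrt s) * ln (q l (sqrt s)) + q' l (sqrt s) * (1 - ln (real M))) / (2 * real M * sqrt s)"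
        by (simp only:)
      with D show ?thesis by (simp only:)
    qed
    then have "(?K has_real_derivative 0 + (\<Sum>l<M. (q' l (sqrt s) * ln (q l (sqrt s))
        + q' l (sqrt s) * (1 - ln (real M))) / (2 * real M * sqrt s))) (at s)"
      by (intro DERIV_add[OF DERIV_const] DERIV_sum) (simp only: lessThan_iff)
    \<comment> \<open>The constant \<open>1 - ln (real M)\<close> multiplies the sum of all
      \<open>q' l\<close>, which is zero because total probability is preserved.\<close>
    also have "0 + (\<Sum>l<M. (q' l (sqrt s) * ln (q l (sqrt s))
        + q' l (sqrt s) * (1 - ln (real M))) / (2 * real M * sqrt s)) = entropy_slope M b1 q q' s"
    proof -
      have "(\<Sum>l<M. (q' l (sqrt s) * ln (q l (sqrt s)) + q' l (sqrt s) * (1 - ln (real M))) / (2 * real M * sqrt s))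
        = ((\<Sum>l<M. q' l (sqrt s) * ln (q l (sqrt s))) + (\<Sum>l<M. q' l (sqrt s)) * (1 - ln (real M))) / (2 * real M * sqrt s)"
        by (simp only: sum_divide_distrib sum_distrib_right sum.distrib add_divide_distrib)
      then show ?thesis using s by (simp add: entropy_slope_def sum_deriv)
    qed
    finally show ?thesis .
  qed
  show ?thesis
  proof (cases "s = 0")
    case False
    with assms show ?thesis
      by (intro has_field_derivative_at_within[OF pos_case]) simp
  next
    case True
    have K0: "?K 0 = 0"
    proof -
      have "?K 0 = ln (real M) + (\<Sum>l<M. 1 / real M * ln (1 / real M))"
        by (intro arg_cong2[where f = "(+)"] sum.cong) (simp_all add: q0)
      also have "\<dots> = 0"
        using M by (simp add: ln_divide_pos)
      finally show ?thesis .
    qed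
    have "isCont (q l) (sqrt 0)" if "l < M" for l
      using deriv[OF that] by (rule DERIV_isCont)
    then have q_lim: "((\<lambda>s. q l (sqrt s)) \<longlongrightarrow> q l (sqrt 0)) (at_right 0)" if "l < M" for l
      using that by (intro isCont_tendsto_compose[of _ "q l"] tendsto_real_sqrt tendsto_ident_at) auto
    have "((\<lambda>s. q l (sqrt s) / real M * ln (q l (sqrt s) / real M))
        \<longlongrightarrow> q l (sqrt 0) / real M * ln (q l (sqrt 0) / real M)) (at_right 0)" if "l < M" for l
      using M that by (intro tendsto_mult tendsto_ln tendsto_divide tendsto_const q_lim) (auto simp: q0)
    then have "(?K \<longlongrightarrow> ?K 0) (at_right 0)"
      by (intro tendsto_add tendsto_const tendsto_sum) simp
    then have K_lim: "(?K \<longlongrightarrow> 0) (at_right 0)"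
      by (simp only: K0)
    have "((\<lambda>s. ?K s / s) \<longlongrightarrow> entropy_slope M b1 q q' 0) (at_right 0)"
    proof (rule lhopital_right_0[OF K_lim tendsto_ident_at])
      show "\<forall>\<^sub>F s in at_right 0. (?K has_real_derivative entropy_slope M b1 q q' s) (at s)"
        using eventually_at_right_less[of 0] by eventually_elim (rule pos_case)
      show "\<forall>\<^sub>F s in at_right 0. ((\<lambda>s. s) has_real_derivative 1) (at (s::real))"
        by (intro always_eventually allI DERIV_ident)
      show "((\<lambda>s. entropy_slope M b1 q q' s / 1) \<longlongrightarrow> entropy_slope M b1 q q' 0) (at_right 0)"
        using entropy_slope_tendsto by simp
    qed (simp_all add: eventually_at_filter)
    then show ?thesis
      by (simp only: True has_field_derivative_iff at_within_Ici_at_right K0 diff_zero)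
  qed
qed

end

section \<open>Power sums of cosines over the constellation\<close>

text \<open>The sum is the real part of a geometric series in a number \<open>w\<close> with
  \<open>w ^ M = 1\<close>. It vanishes unless \<open>w = 1\<close>, that is, unless
  \<open>M\<close> divides \<open>k\<close>.\<close>

lemma sum_cos_roots_of_unity:
  assumes "M > 0"
  shows "(\<Sum>l<M. cos (real k * (2 * pi * real l / real M))) = (if M dvd k then real M else 0)"
proof (cases "M dvd k")
  case True
  then obtain j where "k = M * j" by blast
  then have "real k * (2 * pi * real l / real M) = 2 * real (j * l) * pi" for l
    using assms by simp
  then show ?thesis using True by (simp only: cos_2npi) simp
next
  case False
  define w where "w = cis (2 * pi * real k / real M)"
  have "real M * (2 * pi * real k / real M) = 2 * real k * pi"
    using assms by simp
  then have "w ^ M = cis (2 * real k * pi)"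
    by (simp only: w_def Complex.DeMoivre)
  then have wM: "w ^ M = 1"
    by (simp only: complex_eq_iff cis.simps cos_2npi sin_2npi one_complex.simps)
  have w1: "w \<noteq> 1"
  proof
    assume "w = 1"
    then have "cos (2 * pi * real k / real M) = 1"
      by (metis w_def cis.simps(1) one_complex.simps(1))
    then obtain n :: int where "2 * pi * real k / real M = of_int n * 2 * pi"
      using cos_one_2pi_int by blast
    then have "real k = of_int n * real M"
      using assms by (simp add: field_simps)
    then have "int k = n * int M"
      by (metis of_int_eq_iff of_int_mult of_int_of_nat_eq)
    then have "int M dvd int k" by simp
    then show False using False by simp
  qed
  have "(\<Sum>l<M. w ^ l) = 0"
    using geometric_sum[OF w1, of M] wM by simp
  moreover have "Re (w ^ l) = cos (real k * (2 * pi * real l / real M))" for l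
    by (simp add: w_def Complex.DeMoivre mult_ac)
  ultimately have "(\<Sum>l<M. cos (real k * (2 * pi * real l / real M))) = 0"
    by (metis (no_types, lifting) Re_sum sum.cong zero_complex.simps(1))
  then show ?thesis
    using False by simp
qed

context
  fixes M :: nat
  assumes M: "M \<ge> 2"
begin

lemma sum_cos_power1: "(\<Sum>l<M. cos (2 * pi * real l / real M)) = 0"
  using sum_cos_roots_of_unity[of M 1] M by simp

lemma sum_cos_power2:
  "(\<Sum>l<M. (cos (2 * pi * real l / real M))\<^sup>2) = (if M = 2 then 2 else real M / 2)"
proof -
  have "(cos t)\<^sup>2 = (1 + cos (real 2 * t)) / 2" for t :: real
    by (simp add: cos_double_cos)
  then have "(\<Sum>l<M. (cos (2 * pi * real l / real M))\<^sup>2)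
      = (real M + (\<Sum>l<M. cos (real 2 * (2 * pi * real l / real M)))) / 2"
    by (simp only: sum.distrib flip: sum_divide_distrib) simp
  also have "\<dots> = (if M = 2 then 2 else real M / 2)"
    using M by (subst sum_cos_roots_of_unity) (auto dest!: dvd_imp_le)
  finally show ?thesis .
qed

text \<open>The cube has harmonics 1 and 3. The first sums to zero and the third survives only for
  \<open>M = 3\<close>, which is the source of the infinite second derivative.\<close>

lemma sum_cos_power3:
  "(\<Sum>l<M. (cos (2 * pi * real l / real M)) ^ 3) = (if M = 3 then 3 / 4 else 0)"
proof -
  have "(cos t) ^ 3 = (3 * cos t + cos (real 3 * t)) / 4" for t :: real
    using cos_treble_cos[of t] by simp
  then have "(\<Sum>l<M. (cos (2 * pi * real l / real M)) ^ 3)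
      = (3 * (\<Sum>l<M. cos (2 * pi * real l / real M)) + (\<Sum>l<M. cos (real 3 * (2 * pi * real l / real M)))) / 4"
    by (simp only: sum.distrib sum_distrib_left flip: sum_divide_distrib)
  also have "\<dots> = (if M = 3 then 3 / 4 else 0)"
  proof -
    have "M dvd 3 \<longleftrightarrow> M = 3"
    proof
      assume "M dvd 3"
      then have "M \<le> 3" by (auto dest!: dvd_imp_le)
      then have "M = 2 \<or> M = 3" using M by auto
      then show "M = 3" using \<open>M dvd 3\<close> by auto
    qed simp
    then show ?thesis
      using M by (subst sum_cos_roots_of_unity) (auto simp: sum_cos_power1)
  qed
  finally show ?thesis .
qed

text \<open>Besides its mean, the fourth power has harmonics 2 and 4. Both survive for
  \<open>M = 2\<close>, only the fourth for \<open>M = 4\<close>; the two sums happen to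
  agree.\<close>

lemma sum_cos_power4:
  "(\<Sum>l<M. (cos (2 * pi * real l / real M)) ^ 4)
    = (if M = 2 \<or> M = 4 then 2 else 3 * real M / 8)"
proof -
  have "(cos t) ^ 4 = (3 + 4 * cos (real 2 * t) + cos (real 4 * t)) / 8" for t :: real
  proof -
    have c2: "cos (real 2 * t) = 2 * (cos t)\<^sup>2 - 1"
      using cos_double_cos[of t] by simp
    have "cos (real 4 * t) = 2 * (cos (real 2 * t))\<^sup>2 - 1"
      using cos_double_cos[of "2 * t"] by simp
    then have c4: "cos (real 4 * t) = 2 * (2 * (cos t)\<^sup>2 - 1)\<^sup>2 - 1"
      by (simp only: c2)
    show ?thesis
      unfolding c2 c4 by (simp add: power2_eq_square power4_eq_xxxx algebra_simps)
  qed
  then have "(\<Sum>l<M. (cos (2 * pi * real l / real M)) ^ 4)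
      = (3 * real M + 4 * (\<Sum>l<M. cos (real 2 * (2 * pi * real l / real M)))
        + (\<Sum>l<M. cos (real 4 * (2 * pi * real l / real M)))) / 8"
    by (simp only: sum.distrib sum_distrib_left flip: sum_divide_distrib) simp
  also have "\<dots> = (if M = 2 \<or> M = 4 then 2 else 3 * real M / 8)"
  proof -
    have "M dvd 2 \<longleftrightarrow> M = 2"
      using M by (auto dest!: dvd_imp_le)
    moreover have "M dvd 4 \<longleftrightarrow> M = 2 \<or> M = 4"
    proof
      assume "M dvd 4"
      then have "M \<le> 4" by (auto dest!: dvd_imp_le)
      then have "M = 2 \<or> M = 3 \<or> M = 4" using M by auto
      then show "M = 2 \<or> M = 4" using \<open>M dvd 4\<close> by auto
    qed auto
    ultimately show ?thesis
      using M by (simp only: sum_cos_roots_of_unity) auto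
  qed
  finally show ?thesis .
qed

end

section \<open>Coefficients for phase-shift keying\<close>

text \<open>The argument is the amplitude \<open>x = sqrt snr\<close> and ranges over all reals: in
  this variable the probability is differentiable on both sides of \<open>0\<close>.\<close>

definition sector_prob :: "nat \<Rightarrow> nat \<Rightarrow> real \<Rightarrow> real" where
  "sector_prob M l x =
     integral {(2 * real l - 1) * pi / real M..(2 * real l + 1) * pi / real M} (angle_density x)"

definition sector_prob_deriv :: "nat \<Rightarrow> nat \<Rightarrow> real \<Rightarrow> real" where
  "sector_prob_deriv M l x =
     (ray_flux x ((2 * real l + 1) * pi / real M) - ray_flux x ((2 * real l - 1) * pi / real M)) / pi"

lemma sector_le: "(2 * real l - 1) * pi / real M \<le> (2 * real l + 1) * pi / real M"
  by (intro divide_right_mono mult_right_mono) auto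

lemma DERIV_sector_prob: "(sector_prob M l has_real_derivative sector_prob_deriv M l x) (at x)"
  unfolding sector_prob_def sector_prob_deriv_def
  by (rule DERIV_integral_angle_density[OF sector_le])

lemma sector_prob_0:
  assumes "M > 0"
  shows "sector_prob M l 0 = 1 / real M"
proof -
  have "angle_density 0 = (\<lambda>_. 1 / (2 * pi))"
    by (simp add: angle_density_def fun_eq_iff)
  moreover have "(2 * real l + 1) * pi / real M - (2 * real l - 1) * pi / real M = 2 * pi / real M"
    using assms by (simp add: field_simps)
  ultimately show ?thesis
    using sector_le[of l M] by (simp add: sector_prob_def)
qed

text \<open>A continuous nonnegative function with zero integral over a nondegenerate interval
  vanishes there, and the angular density vanishes nowhere.\<close>

lemma sector_prob_pos:
  assumes "M > 0"
  shows "sector_prob M l x > 0"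
proof -
  let ?I = "{(2 * real l - 1) * pi / real M..(2 * real l + 1) * pi / real M}"
  have int: "angle_density x integrable_on ?I"
    by (intro integrable_continuous_interval continuous_intros)
  have "sector_prob M l x \<noteq> 0"
  proof
    assume "sector_prob M l x = 0"
    then have "(angle_density x has_integral 0) (cbox ((2 * real l - 1) * pi / real M) ((2 * real l + 1) * pi / real M))"
      using integrable_integral[OF int] by (simp add: sector_prob_def)
    moreover have "(2 * real l - 1) * pi / real M < (2 * real l + 1) * pi / real M"
      using assms by (intro divide_strict_right_mono mult_strict_right_mono) auto
    ultimately have "angle_density x ((2 * real l - 1) * pi / real M) = 0"
      by (intro has_integral_0_cbox_imp_0[of _ _ "angle_density x"])
        (auto intro!: continuous_intros less_imp_le angle_density_pos simp: box_eq_empty)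
    then show False using angle_density_pos[of x] by (metis less_irrefl)
  qed
  moreover have "sector_prob M l x \<ge> 0"
    unfolding sector_prob_def
    by (intro integral_nonneg int) (auto intro: less_imp_le angle_density_pos)
  ultimately show ?thesis by simp
qed

text \<open>Neighbouring sectors share a boundary ray, so the fluxes telescope; the last ray is the
  first one after a full turn.\<close>

lemma sum_sector_prob_deriv:
  assumes "M > 0"
  shows "(\<Sum>l<M. sector_prob_deriv M l x) = 0"
proof -
  define f where "f l = ray_flux x ((2 * real l - 1) * pi / real M) / pi" for l
  have "sector_prob_deriv M l x = f (Suc l) - f l" for l
    by (simp add: sector_prob_deriv_def f_def diff_divide_distrib algebra_simps)
  then have "(\<Sum>l<M. sector_prob_deriv M l x) = f M - f 0"
    by (simp add: sum_lessThan_telescope)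
  also have "(2 * real M - 1) * pi / real M = - pi / real M + 2 * pi"
    using assms by (simp add: field_simps)
  then have "f M = f 0"
    by (simp add: f_def ray_flux_def)
  finally show ?thesis by simp
qed

text \<open>Taylor coefficients of \<open>M * sector_prob M l x\<close> at \<open>x = 0\<close>, written as polynomials in the cosine
  of the sector's central angle so that only cosine power sums remain to be evaluated.\<close>

definition sector_coeff1 :: "nat \<Rightarrow> nat \<Rightarrow> real" where
  "sector_coeff1 M l = real M * sin (pi / real M) / sqrt pi * cos (2 * pi * real l / real M)"

definition sector_coeff2 :: "nat \<Rightarrow> nat \<Rightarrow> real" where
  "sector_coeff2 M l = real M * sin (pi / real M) * cos (pi / real M) / pi
     * (2 * (cos (2 * pi * real l / real M))\<^sup>2 - 1)"

definition sector_coeff3 :: "nat \<Rightarrow> nat \<Rightarrow> real" where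
  "sector_coeff3 M l = - (real M * sin (pi / real M) / (3 * sqrt pi)
     * (3 * (1 - (sin (pi / real M))\<^sup>2) * cos (2 * pi * real l / real M)
        + (4 * (sin (pi / real M))\<^sup>2 - 3) * (cos (2 * pi * real l / real M)) ^ 3))"

lemma div_pi_mult_sqrt_pi: "x / pi * sqrt pi = x / sqrt pi"
  using sqrt_divide_self_eq[of pi] by (simp add: divide_inverse mult_ac)

text \<open>The flux expansions at the boundary angles \<open>t + h\<close> and \<open>t - h\<close>
  are subtracted, where \<open>t\<close> is the centre of the sector and \<open>h\<close> half its
  width.\<close>

lemma sector_prob_deriv_expansion:
  assumes "M > 0"
  shows "((\<lambda>x. (real M * sector_prob_deriv M l x - sector_coeff1 M l - 2 * sector_coeff2 M l * x) / x\<^sup>2)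
    \<longlongrightarrow> 3 * sector_coeff3 M l) (at_right 0)"
proof -
  define h where "h = pi / real M"
  define t where "t = 2 * pi * real l / real M"
  define \<sigma> z s k where defs: "\<sigma> = sin t" "z = cos t" "s = sin h" "k = cos h"
  have ends: "(2 * real l + 1) * pi / real M = t + h" "(2 * real l - 1) * pi / real M = t - h"
    by (simp_all add: t_def h_def add_divide_distrib diff_divide_distrib algebra_simps)
  have vals: "sin (t + h) = \<sigma> * k + z * s" "sin (t - h) = \<sigma> * k - z * s"
    "cos (t + h) = z * k - \<sigma> * s" "cos (t - h) = z * k + \<sigma> * s"
    by (simp_all add: defs sin_add sin_diff cos_add cos_diff)
  have \<sigma>2: "\<sigma> * \<sigma> = 1 - z * z" and k2: "k * k = 1 - s * s"
    using sin_cos_squared_add[of t] sin_cos_squared_add[of h]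
    by (simp_all add: defs power2_eq_square algebra_simps)
  let ?r = "sqrt pi"
  let ?A = "\<lambda>\<theta> x. (ray_flux x \<theta> - ?r / 2 * sin \<theta> - sin \<theta> * cos \<theta> * x) / x\<^sup>2"
  have "((\<lambda>x. real M / pi * (?A (t + h) x - ?A (t - h) x))
      \<longlongrightarrow> real M / pi * (- (?r / 2 * (sin (t + h)) ^ 3) - - (?r / 2 * (sin (t - h)) ^ 3))) (at_right 0)"
    by (intro tendsto_intros ray_flux_expansion)
  also have "real M / pi * (- (?r / 2 * (sin (t + h)) ^ 3) - - (?r / 2 * (sin (t - h)) ^ 3))
      = 3 * sector_coeff3 M l"
  proof -
    \<comment> \<open>Odd powers of \<open>\<sigma>\<close> cancel in the difference; the squares of
      \<open>\<sigma>\<close> and \<open>k\<close> are then eliminated in favour of \<open>z\<close>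
      and \<open>s\<close>.\<close>
    have "(\<sigma> * k + z * s) ^ 3 - (\<sigma> * k - z * s) ^ 3 = 2 * z * s * (3 * (\<sigma> * \<sigma>) * (k * k) + z\<^sup>2 * s\<^sup>2)"
      by (simp add: power2_eq_square power3_eq_cube algebra_simps)
    also have "\<dots> = 2 * s * (3 * (1 - s\<^sup>2) * z + (4 * s\<^sup>2 - 3) * z ^ 3)"
      unfolding \<sigma>2 k2 by (simp add: power2_eq_square power3_eq_cube algebra_simps)
    finally have cubes: "(\<sigma> * k + z * s) ^ 3 - (\<sigma> * k - z * s) ^ 3
        = 2 * s * (3 * (1 - s\<^sup>2) * z + (4 * s\<^sup>2 - 3) * z ^ 3)" .
    have "real M / pi * (- (?r / 2 * X) - - (?r / 2 * Y)) = - (real M / pi * ?r * ((X - Y) / 2))" for X Y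
      by (simp add: field_simps)
    from this[of "(\<sigma> * k + z * s) ^ 3" "(\<sigma> * k - z * s) ^ 3"]
    have "real M / pi * (- (?r / 2 * (\<sigma> * k + z * s) ^ 3) - - (?r / 2 * (\<sigma> * k - z * s) ^ 3))
        = - (real M / pi * ?r * (s * (3 * (1 - s\<^sup>2) * z + (4 * s\<^sup>2 - 3) * z ^ 3)))"
      unfolding cubes by simp
    also have "real M / pi * ?r = real M / ?r"
      by (rule div_pi_mult_sqrt_pi)
    finally show ?thesis
      unfolding vals by (simp add: sector_coeff3_def t_def[symmetric] h_def[symmetric] defs[symmetric])
  qed
  finally show ?thesis
  proof (rule filterlim_cong[THEN iffD1, rotated -1])
    have c1: "real M / pi * (?r / 2 * sin (t + h) - ?r / 2 * sin (t - h)) = sector_coeff1 M l"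
    proof -
      have "real M / pi * (?r / 2 * sin (t + h) - ?r / 2 * sin (t - h)) = real M / pi * ?r * (z * s)"
        unfolding vals by (simp add: algebra_simps)
      also have "real M / pi * ?r = real M / ?r"
        by (rule div_pi_mult_sqrt_pi)
      finally show ?thesis
        by (simp add: sector_coeff1_def t_def[symmetric] h_def[symmetric] defs[symmetric])
    qed
    have c2: "real M / pi * (sin (t + h) * cos (t + h) - sin (t - h) * cos (t - h)) = 2 * sector_coeff2 M l"
    proof -
      have "(\<sigma> * k + z * s) * (z * k - \<sigma> * s) - (\<sigma> * k - z * s) * (z * k + \<sigma> * s)
          = 2 * s * k * (z * z - \<sigma> * \<sigma>)"
        by (simp add: algebra_simps)
      then show ?thesis
        unfolding vals \<sigma>2
        by (simp add: sector_coeff2_def t_def[symmetric] h_def[symmetric] defs[symmetric] power2_eq_square)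
    qed
    show "\<forall>\<^sub>F x in at_right 0. real M / pi * (?A (t + h) x - ?A (t - h) x)
        = (real M * sector_prob_deriv M l x - sector_coeff1 M l - 2 * sector_coeff2 M l * x) / x\<^sup>2"
    proof (intro always_eventually allI)
      fix x
      have "real M / pi * (?A (t + h) x - ?A (t - h) x)
        = (real M * ((ray_flux x (t + h) - ray_flux x (t - h)) / pi)
           - real M / pi * (?r / 2 * sin (t + h) - ?r / 2 * sin (t - h))
           - real M / pi * (sin (t + h) * cos (t + h) - sin (t - h) * cos (t - h)) * x) / x\<^sup>2"
        by (simp add: diff_divide_distrib add_divide_distrib algebra_simps)
      then show "real M / pi * (?A (t + h) x - ?A (t - h) x)
        = (real M * sector_prob_deriv M l x - sector_coeff1 M l - 2 * sector_coeff2 M l * x) / x\<^sup>2"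
        by (simp only: c1 c2 sector_prob_deriv_def ends)
    qed
  qed simp_all
qed

section \<open>Sums of the entropy coefficients over all sectors\<close>

lemma sum_entropy_coeff1:
  assumes "M \<ge> 2"
  shows "(\<Sum>l<M. (sector_coeff1 M l)\<^sup>2) / (2 * real M)
    = (if M = 2 then 2 / pi else (real M)\<^sup>2 / (4 * pi) * (sin (pi / real M))\<^sup>2)"
proof -
  have "(sector_coeff1 M l)\<^sup>2 = (real M)\<^sup>2 * (sin (pi / real M))\<^sup>2 / pi * (cos (2 * pi * real l / real M))\<^sup>2" for l
    by (simp add: sector_coeff1_def power_mult_distrib power_divide)
  then have "(\<Sum>l<M. (sector_coeff1 M l)\<^sup>2) / (2 * real M)
      = (real M)\<^sup>2 * (sin (pi / real M))\<^sup>2 / pi * (\<Sum>l<M. (cos (2 * pi * real l / real M))\<^sup>2) / (2 * real M)"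
    by (simp only: sum_distrib_left)
  also have "\<dots> = (if M = 2 then 2 / pi else (real M)\<^sup>2 / (4 * pi) * (sin (pi / real M))\<^sup>2)"
    using assms by (subst sum_cos_power2) (auto simp: power2_eq_square)
  finally show ?thesis .
qed

text \<open>Each summand is a combination of the cosine and its cube, so the sum can be nonzero only
  for \<open>M = 3\<close>. There its sign is that of the cubic coefficient
  \<open>2 * A - B\<close>.\<close>

lemma sum_entropy_coeff2:
  fixes M :: nat
  assumes M: "M \<ge> 2"
  defines "S \<equiv> (\<Sum>l<M. 3 * sector_coeff1 M l * sector_coeff2 M l - sector_coeff1 M l ^ 3 / 2)"
  shows "M \<noteq> 3 \<Longrightarrow> S = 0" and "M = 3 \<Longrightarrow> S > 0"
proof -
  let ?s = "sin (pi / real M)" and ?k = "cos (pi / real M)" and ?z = "\<lambda>l. cos (2 * pi * real l / real M)"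
  define A where "A = 3 * (real M * ?s / sqrt pi) * (real M * ?s * ?k / pi)"
  define B where "B = (real M * ?s / sqrt pi) ^ 3 / 2"
  have "3 * sector_coeff1 M l * sector_coeff2 M l - sector_coeff1 M l ^ 3 / 2
      = (2 * A - B) * ?z l ^ 3 - A * ?z l" for l
    unfolding sector_coeff1_def sector_coeff2_def power_mult_distrib A_def B_def
    by (simp add: power3_eq_cube power2_eq_square algebra_simps)
  then have S: "S = (2 * A - B) * (if M = 3 then 3 / 4 else 0)"
    unfolding S_def
    by (simp only: sum_subtractf sum_cos_power1[OF M] sum_cos_power3[OF M] flip: sum_distrib_left)
  show "M \<noteq> 3 \<Longrightarrow> S = 0" using S by simp
  show "S > 0" if "M = 3"
  proof -
    \<comment> \<open>The angle \<open>pi / 3\<close> has sine \<open>sqrt 3 / 2\<close> and cosine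
      \<open>1 / 2\<close>, so \<open>2 * A - B\<close> is a positive multiple of
      \<open>4 - sqrt 3\<close>.\<close>
    have A: "A = 81 / (8 * (sqrt pi * pi))"
      using that by (simp add: A_def sin_60 cos_60)
    have B: "B = 81 * sqrt 3 / (16 * (sqrt pi * pi))"
      using that by (simp add: B_def sin_60 power3_eq_cube)
    have "sqrt 3 < 4"
      by (rule real_less_lsqrt) simp_all
    then have "81 * (4 - sqrt 3) / (16 * (sqrt pi * pi)) > 0"
      by simp
    also have "81 * (4 - sqrt 3) / (16 * (sqrt pi * pi)) = 2 * A - B"
      by (simp add: A B field_simps)
    finally show ?thesis using S that by simp
  qed
qed

text \<open>Each summand is an even polynomial of degree four in the cosine, so the power sums
  decide. \<open>M = 3\<close> falls under the generic formula: there the value is the finite part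
  left after the singular term is subtracted.\<close>

lemma sum_entropy_coeff3:
  fixes M :: nat
  assumes M: "M \<ge> 2"
  shows "(\<Sum>l<M. 4 * sector_coeff1 M l * sector_coeff3 M l - 2 * (sector_coeff1 M l)\<^sup>2 * sector_coeff2 M l
      + sector_coeff1 M l ^ 4 / 3 + 2 * (sector_coeff2 M l)\<^sup>2) / (2 * real M)
    = (if M = 2 then 8 / (3 * pi) * (1 / pi - 1)
       else if M = 4 then 4 / (3 * pi) * (1 / pi - 1)
       else psk_psi M)"
proof -
  define s k where defs: "s = sin (pi / real M)" "k = cos (pi / real M)"
  let ?z = "\<lambda>l. cos (2 * pi * real l / real M)"
  let ?m = "real M"
  have k2: "k * k = 1 - s * s"
    using sin_cos_squared_add[of "pi / real M"] by (simp add: defs power2_eq_square algebra_simps)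
  define P2 P4 where P: "P2 = (\<Sum>l<M. ?z l ^ 2)" "P4 = (\<Sum>l<M. ?z l ^ 4)"
  define c0 where "c0 = 2 * ?m\<^sup>2 * s\<^sup>2 * k\<^sup>2 / pi\<^sup>2"
  define c2 where "c2 = - 4 * ?m\<^sup>2 * s\<^sup>2 * (1 - s\<^sup>2) / pi + 2 * ?m ^ 3 * s ^ 3 * k / pi\<^sup>2
      - 8 * ?m\<^sup>2 * s\<^sup>2 * k\<^sup>2 / pi\<^sup>2"
  define c4 where "c4 = - 4 / 3 * ?m\<^sup>2 * s\<^sup>2 * (4 * s\<^sup>2 - 3) / pi - 4 * ?m ^ 3 * s ^ 3 * k / pi\<^sup>2
      + ?m ^ 4 * s ^ 4 / 3 / pi\<^sup>2 + 8 * ?m\<^sup>2 * s\<^sup>2 * k\<^sup>2 / pi\<^sup>2"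
  have "4 * sector_coeff1 M l * sector_coeff3 M l - 2 * (sector_coeff1 M l)\<^sup>2 * sector_coeff2 M l
      + sector_coeff1 M l ^ 4 / 3 + 2 * (sector_coeff2 M l)\<^sup>2 = c0 + c2 * ?z l ^ 2 + c4 * ?z l ^ 4" for l
  proof -
    \<comment> \<open>Expressing all powers of \<open>1 / sqrt pi\<close> through \<open>u\<close>
      makes the claim a polynomial identity.\<close>
    define u z where u_z_def: "u = 1 / sqrt pi" "z = ?z l"
    have u: "x / sqrt pi = x * u" "x / pi = x * (u * u)" "x / pi\<^sup>2 = x * (u * u * u * u)" for x
      by (simp_all add: u_z_def power2_eq_square)
    have b: "sector_coeff1 M l = ?m * s * u * z"
      "sector_coeff2 M l = ?m * s * k * (u * u) * (2 * z\<^sup>2 - 1)"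
      "sector_coeff3 M l = - (?m * s * u / 3 * (3 * (1 - s\<^sup>2) * z + (4 * s\<^sup>2 - 3) * z ^ 3))"
      by (simp_all add: sector_coeff1_def sector_coeff2_def sector_coeff3_def u_z_def(2) defs(1,2) flip: u)
    then show ?thesis
      unfolding b c0_def c2_def c4_def u u_z_def(2)[symmetric]
      by (simp add: power2_eq_square power3_eq_cube power4_eq_xxxx field_simps)
  qed
  then have sum_eq: "(\<Sum>l<M. 4 * sector_coeff1 M l * sector_coeff3 M l - 2 * (sector_coeff1 M l)\<^sup>2 * sector_coeff2 M l
      + sector_coeff1 M l ^ 4 / 3 + 2 * (sector_coeff2 M l)\<^sup>2) = ?m * c0 + c2 * P2 + c4 * P4"
    by (simp add: P sum.distrib flip: sum_distrib_left)
  have P2: "P2 = (if M = 2 then 2 else ?m / 2)"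
    and P4: "P4 = (if M = 2 \<or> M = 4 then 2 else 3 * ?m / 8)"
    by (simp_all only: P sum_cos_power2[OF M] sum_cos_power4[OF M])
  consider "M = 2" | "M = 4" | "M \<noteq> 2" "M \<noteq> 4" by blast
  then have "(?m * c0 + c2 * P2 + c4 * P4) / (2 * ?m)
    = (if M = 2 then 8 / (3 * pi) * (1 / pi - 1)
       else if M = 4 then 4 / (3 * pi) * (1 / pi - 1)
       else psk_psi M)"
  proof cases
    \<comment> \<open>Here \<open>s = 1\<close> and \<open>k = 0\<close>, so every term containing
      \<open>k\<close> vanishes.\<close>
    case 1
    then show ?thesis
      by (simp add: P2 P4 c0_def c2_def c4_def defs
          power2_eq_square field_simps)
  next
    case 2
    have ss: "s * s = 1 / 2" and ks: "k = s"
      using 2 by (simp_all add: defs sin_45 cos_45)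
    have s2: "s\<^sup>2 = 1 / 2" "s ^ 3 * s = 1 / 4" "s ^ 4 = 1 / 4"
    proof -
      have "(s * s) * (s * s) = 1 / 4" by (simp only: ss)
      then show "s ^ 3 * s = 1 / 4" "s ^ 4 = 1 / 4"
        by (simp_all only: power3_eq_cube power4_eq_xxxx mult.assoc)
    qed (simp add: power2_eq_square ss)
    have s4: "x * s ^ 3 * s = x / 4" for x
      using s2(2) by (simp only: mult.assoc)
    have c: "c0 = 8 / pi\<^sup>2" "c2 = - 16 / pi" "c4 = 32 / (3 * pi) - 32 / (3 * pi\<^sup>2)"
      unfolding c0_def c2_def c4_def ks s2(1,3) s4 by (simp_all add: 2 field_simps)
    show ?thesis
      unfolding P2 P4 c using 2 by (simp add: field_simps power2_eq_square)
  next
    case 3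
    have "sin (2 * pi / ?m) = 2 * s * k"
      using sin_double[of "pi / ?m"] by (simp add: defs)
    define w where "w = 1 / pi"
    have w: "x / pi = x * w" "x / pi\<^sup>2 = x * (w * w)" for x
      by (simp_all add: w_def power2_eq_square)
    have "psk_psi M = ?m\<^sup>2 / 16 * (((2 - pi) * (sin (2 * pi / ?m))\<^sup>2
        + (?m\<^sup>2 - 4 * pi) * s ^ 4 - 2 * ?m * s\<^sup>2 * sin (2 * pi / ?m)) / pi\<^sup>2)"
      by (simp add: psk_psi_def defs)
    also have "((2 - pi) * X + (?m\<^sup>2 - 4 * pi) * Y - Z) / pi\<^sup>2
        = (2 * w * w - w) * X + (?m\<^sup>2 * w * w - 4 * w) * Y - Z * w * w" for X Y Z
      by (simp add: w_def power2_eq_square field_simps)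
    finally have psi: "psk_psi M = ?m\<^sup>2 / 16 * ((2 * w * w - w) * (4 * (s * s) * (k * k))
        + (?m\<^sup>2 * w * w - 4 * w) * s ^ 4 - 4 * ?m * (s * s * s) * k * w * w)"
      unfolding \<open>sin (2 * pi / ?m) = 2 * s * k\<close> by (simp add: power2_eq_square mult_ac)
    \<comment> \<open>The generic power sums \<open>?m / 2\<close> and \<open>3 * ?m / 8\<close>
      become the weights \<open>1 / 4\<close> and \<open>3 / 16\<close> after division by
      \<open>2 * ?m\<close>.\<close>
    have "(?m * c0 + c2 * P2 + c4 * P4) / (2 * ?m) = c0 / 2 + c2 / 4 + 3 * c4 / 16"
      using 3 M by (simp add: P2 P4 field_simps)
    also have "\<dots> = psk_psi M"
      unfolding psi c0_def c2_def c4_def w power2_eq_square[of k] k2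
      by (simp add: power2_eq_square power3_eq_cube power4_eq_xxxx field_simps)
    finally show ?thesis using 3 by simp
  qed
  then show ?thesis by (simp only: sum_eq)
qed

section \<open>Right derivatives of the capacity at zero signal-to-noise ratio\<close>

theorem theorem1:
  fixes M :: nat and N0 :: real
  assumes "M \<ge> 2" and "N0 > 0"
  shows "\<exists>C'.
    (\<forall>x\<ge>0. (psk_capacity M N0 has_real_derivative C' x) (at x within {0..})) \<and>
    C' 0 = (if M = 2 then 2 / pi else (real M)\<^sup>2 / (4 * pi) * (sin (pi / real M))\<^sup>2) \<and>
    (if M = 3 then filterlim (\<lambda>h. (C' h - C' 0) / h) at_top (at_right 0)
     else (C' has_real_derivative
             (if M = 2 then 8 / (3 * pi) * (1 / pi - 1)
              else if M = 4 then 4 / (3 * pi) * (1 / pi - 1)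
              else psk_psi M)) (at 0 within {0..}))"
proof -
  define q where "q l x = real M * sector_prob M l x" for l x
  define q' where "q' l x = real M * sector_prob_deriv M l x" for l x
  let ?b1 = "sector_coeff1 M" and ?b2 = "sector_coeff2 M" and ?b3 = "sector_coeff3 M"
  define C' where "C' = entropy_slope M ?b1 q q'"
  have M: "M > 0" using assms by simp
  have deriv: "(q l has_real_derivative q' l x) (at x)" for l x
    unfolding q_def q'_def by (intro DERIV_cmult DERIV_sector_prob)
  have q0: "q l 0 = 1" for l
    using M by (simp add: q_def sector_prob_0)
  have pos: "q l x > 0" for l x
    using M by (simp add: q_def sector_prob_pos)
  have sum_deriv: "(\<Sum>l<M. q' l x) = 0" for x
    using sum_sector_prob_deriv[OF M] by (simp add: q'_def flip: sum_distrib_left)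
  have lim: "((\<lambda>x. (q' l x - ?b1 l - 2 * ?b2 l * x) / x\<^sup>2) \<longlongrightarrow> 3 * ?b3 l) (at_right 0)" for l
    unfolding q'_def by (rule sector_prob_deriv_expansion[OF M])
  note hyps = M deriv q0 pos sum_deriv lim
  have capacity: "psk_capacity M N0 s = ln (real M) + (\<Sum>l<M. q l (sqrt s) / real M * ln (q l (sqrt s) / real M))"
    if "s \<ge> 0" for s
    using that assms M by (simp add: psk_capacity_def psk_prob_0 q_def sector_prob_def)
  have capacity_deriv: "(psk_capacity M N0 has_real_derivative C' x) (at x within {0..})" if "x \<ge> 0" for x
    unfolding C'_def
    by (rule has_field_derivative_transform_within[OF DERIV_entropy[OF hyps that] zero_less_one])
      (use that in \<open>simp_all add: capacity\<close>)
  have C0: "C' 0 = (if M = 2 then 2 / pi else (real M)\<^sup>2 / (4 * pi) * (sin (pi / real M))\<^sup>2)"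
    unfolding C'_def entropy_slope_def using sum_entropy_coeff1[OF assms(1)] by simp
  let ?S = "\<Sum>l<M. 3 * ?b1 l * ?b2 l - ?b1 l ^ 3 / 2"
  let ?L = "if M = 2 then 8 / (3 * pi) * (1 / pi - 1)
              else if M = 4 then 4 / (3 * pi) * (1 / pi - 1) else psk_psi M"
  have expansion: "((\<lambda>h. (C' h - C' 0) / h - ?S / (2 * real M * sqrt h)) \<longlongrightarrow> ?L) (at_right 0)"
    using entropy_slope_expansion[OF hyps] unfolding C'_def sum_entropy_coeff3[OF assms(1)] .
  \<comment> \<open>Here \<open>?S\<close> vanishes, so the expansion is the limit of the difference
    quotient itself.\<close>
  have second_deriv: "(C' has_real_derivative ?L) (at 0 within {0..})" if "M \<noteq> 3"
    using expansion sum_entropy_coeff2(1)[OF assms(1) that]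
    by (simp add: has_field_derivative_iff at_within_Ici_at_right)
  have divergence: "filterlim (\<lambda>h. (C' h - C' 0) / h) at_top (at_right 0)" if "M = 3"
  proof -
    have S: "?S / (2 * real M) > 0"
      using sum_entropy_coeff2(2)[OF assms(1) that] M by simp
    have "filterlim (\<lambda>h. c / sqrt h) at_top (at_right 0)" if "c > 0" for c :: real
      using that by real_asymp
    from this[OF S] have "filterlim (\<lambda>h. ?S / (2 * real M * sqrt h)) at_top (at_right 0)"
      by simp
    \<comment> \<open>The difference quotient is a convergent term plus a positive multiple of
      \<open>1 / sqrt h\<close>.\<close>
    from filterlim_tendsto_add_at_top[OF expansion this] show ?thesis
      by (simp only: diff_add_cancel)
  qed
  show ?thesis
    using capacity_deriv C0 second_deriv divergence
    by (intro exI[of _ C'] conjI allI impI if_bool_eq_conj[THEN iffD2])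
qed

end
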